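(* Let $\mathbb{X}$ be a locally compact second countable Hausdorff space with Borel $\sigma$-algebra $\mathcal{X}$. Let $\xi$ be a finite point process on $\mathbb{X}$ with intensity measure $\mathbf{L}$ such that $\mathbf{L}(\mathbb{X})<\infty$. Let $\zeta$ be a Poisson process on $\mathbb{X}$ with a finite intensity measure $\mathbf{M}$. Suppose that for $\mathbf{L}$-a.e. $x\in\mathbb{X}$ there are coupled point processes $\xi^{x},\tilde{\xi}^{x}$ (defined on a common probability space) such that $\xi^{x}\stackrel{d}{=}\xi$ and $\tilde{\xi}^{x}\stackrel{d}{=}\xi^{!}_{x}$, where $\xi^!_x$ denotes the reduced Palm version of $\xi$ at $x$. Assume also that $x\mapsto \mathbb{E}\{(\xi^{x}\triangle\tilde{\xi}^{x})(\mathbb{X})\}$ is measurable. Then $$\mathbf{d_{KR}}(\xi,\zeta)\le d_{TV}(\mathbf{L},\mathbf{M})+2\int_{\mathbb{X}}\mathbb{E}\{(\xi^{x}\triangle\tilde{\xi}^{x})(\mathbb{X})\}\,\mathbf{L}(\mathrm{d}x).$$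
   Context: $\mathbf{N}_{\mathbb{X}}$ (resp. $\widehat{\mathbf{N}}_{\mathbb{X}}$) is the space of $\sigma$-finite (resp. finite) counting measures on $\mathbb{X}$, with the $\sigma$-algebra generated by the maps $\omega\mapsto\omega(B)$, $B\in\mathcal{X}$. A point process is a random element of $\mathbf{N}_{\mathbb{X}}$; it is finite if it takes values in $\widehat{\mathbf{N}}_{\mathbb{X}}$. Counting measures are identified with multisets of points. For counting measures $\omega_1,\omega_2$, $\omega_1\setminus\omega_2$ denotes the multiset difference (with multiplicities) and $\omega_1\triangle\omega_2:=\omega_1\setminus\omega_2+\omega_2\setminus\omega_1$. The intensity measure of a point process $\xi$ is $\mathbf{L}(A)=\mathbb{E}\{\xi(A)\}$, $A\in\mathcal{X}$. The reduced Palm version $\xi^!_x$ (defined for $\mathbf{L}$-a.e. $x$) is a point process whose distribution is determined by $$\mathbb{E}\Big\{\sum_{x\in\xi}f(x,\xi)\Big\}=\int_{\mathbb{X}}\mathbb{E}\{f(x,\xi^!_x+\delta_x)\}\,\mathbf{L}(\mathrm{d}x)$$ for all measurable $f:\mathbb{X}\times\mathbf{N}_{\mathbb{X}}\to[0,\infty)$. For measures $\mu_1,\mu_2$ on $\mathbb{X}$, $d_{TV}(\mu_1,\mu_2):=\sup\{|\mu_1(A)-\mu_2(A)|: A\in\mathcal{X},\ \mu_1(A),\mu_2(A)<\infty\}$. The Kantorovich–Rubinstein distance between finite point processes is $\mathbf{d_{KR}}(\xi,\zeta):=\sup_{h}|\mathbb{E}\{h(\xi)\}-\mathbb{E}\{h(\zeta)\}|$,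 where the supremum is over all measurable $h:\widehat{\mathbf{N}}_{\mathbb{X}}\to\mathbb{R}$ with $|h(\omega_1)-h(\omega_2)|\le d_{TV}(\omega_1,\omega_2)$ for all $\omega_1,\omega_2\in\widehat{\mathbf{N}}_{\mathbb{X}}$. *)

theory Defs
  imports "HOL-Probability.Probability"
begin

definition counting_measures :: "'a::topological_space measure set" where
  "counting_measures =
     {\<omega>. sets \<omega> = sets borel \<and> sigma_finite_measure \<omega> \<and>
          (\<forall>A\<in>sets borel. emeasure \<omega> A \<in> \<nat> \<union> {\<infinity>})}"

definition finite_counting_measures :: "'a::topological_space measure set" where
  "finite_counting_measures = {\<omega> \<in> counting_measures. emeasure \<omega> UNIV < \<infinity>}"

definition evaluation_space :: "'a::topological_space measure set \<Rightarrow> 'a measure measure" where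
  "evaluation_space S = (SUP B \<in> sets borel. vimage_algebra S (\<lambda>\<omega>. emeasure \<omega> B) borel)"

abbreviation counting_space :: "'a::topological_space measure measure" where
  "counting_space \<equiv> evaluation_space counting_measures"

abbreviation finite_counting_space :: "'a::topological_space measure measure" where
  "finite_counting_space \<equiv> evaluation_space finite_counting_measures"

definition measure_add :: "'a measure \<Rightarrow> 'a measure \<Rightarrow> 'a measure" where
  "measure_add \<mu> \<nu> = measure_of (space \<mu>) (sets \<mu>) (\<lambda>A. emeasure \<mu> A + emeasure \<nu> A)"

text \<open>
  The multiset corresponding to a sigma-finite counting measure has the point \<open>x\<close> with
  multiplicity \<open>emeasure \<omega> {x}\<close>, which is finite. Subtraction on \<^typ>\<open>ennreal\<close> is truncated at
  zero, hence is the subtraction of multiplicities in a multiset difference.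
\<close>

definition multiset_diff ::
    "'a::topological_space measure \<Rightarrow> 'a measure \<Rightarrow> 'a measure" where
  "multiset_diff \<omega>1 \<omega>2 =
     distr (density (count_space UNIV) (\<lambda>x. emeasure \<omega>1 {x} - emeasure \<omega>2 {x})) borel (\<lambda>x. x)"

definition multiset_sym_diff ::
    "'a::topological_space measure \<Rightarrow> 'a measure \<Rightarrow> 'a measure" where
  "multiset_sym_diff \<omega>1 \<omega>2 = measure_add (multiset_diff \<omega>1 \<omega>2) (multiset_diff \<omega>2 \<omega>1)"

definition point_process :: "'w measure \<Rightarrow> ('w \<Rightarrow> 'a::topological_space measure) \<Rightarrow> bool" where
  "point_process P \<xi> \<longleftrightarrow> prob_space P \<and> \<xi> \<in> measurable P counting_space"

definition finite_point_process ::
    "'w measure \<Rightarrow> ('w \<Rightarrow> 'a::topological_space measure) \<Rightarrow> bool" where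
  "finite_point_process P \<xi> \<longleftrightarrow>
     point_process P \<xi> \<and> (\<forall>w\<in>space P. \<xi> w \<in> finite_counting_measures)"

definition intensity ::
    "'w measure \<Rightarrow> ('w \<Rightarrow> 'a::topological_space measure) \<Rightarrow> 'a measure" where
  "intensity P \<xi> = measure_of UNIV (sets borel) (\<lambda>A. \<integral>\<^sup>+w. emeasure (\<xi> w) A \<partial>P)"

text \<open>
  For a sigma-finite \<open>M\<close> the two conditions below also force \<open>\<xi>(B) = \<infinity>\<close> almost surely if
  \<open>M(B) = \<infinity>\<close>. If \<open>M(B) = 0\<close>, the formula is the point mass at zero, because \<open>0 ^ 0 = 1\<close>.
\<close>

definition poisson_process ::
    "'w measure \<Rightarrow> 'a::topological_space measure \<Rightarrow> ('w \<Rightarrow> 'a measure) \<Rightarrow> bool" where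
  "poisson_process P M \<xi> \<longleftrightarrow>
     point_process P \<xi> \<and> sets M = sets borel \<and> sigma_finite_measure M \<and>
     (\<forall>B\<in>sets borel. emeasure M B < \<infinity> \<longrightarrow>
        (\<forall>k::nat. measure P {w\<in>space P. emeasure (\<xi> w) B = of_nat k} =
           measure M B ^ k / fact k * exp (- measure M B))) \<and>
     (\<forall>(B::nat \<Rightarrow> 'a set) n. (\<forall>i<n. B i \<in> sets borel) \<and> disjoint_family_on B {..<n} \<longrightarrow>
        prob_space.indep_vars P (\<lambda>_. borel) (\<lambda>i w. emeasure (\<xi> w) (B i)) {..<n})"

text \<open>
  A reduced Palm version is a family of point processes \<open>\<eta> x\<close> on probability spaces \<open>R x\<close>, given
  for almost every \<open>x\<close> with respect to the intensity measure. As the expectation on the right-hand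
  side is defined only almost everywhere, its measurability in \<open>x\<close> refers to the completion.
\<close>

definition reduced_palm_version ::
    "'w measure \<Rightarrow> ('w \<Rightarrow> 'a::topological_space measure) \<Rightarrow>
     ('a \<Rightarrow> 'r measure) \<Rightarrow> ('a \<Rightarrow> 'r \<Rightarrow> 'a measure) \<Rightarrow> bool" where
  "reduced_palm_version P \<xi> R \<eta> \<longleftrightarrow>
     (AE x in intensity P \<xi>. point_process (R x) (\<eta> x)) \<and>
     (\<forall>f::'a \<times> 'a measure \<Rightarrow> real.
        f \<in> borel_measurable (borel \<Otimes>\<^sub>M counting_space) \<and> (\<forall>z. 0 \<le> f z) \<longrightarrow>
        (\<lambda>x. \<integral>\<^sup>+w. ennreal (f (x, measure_add (\<eta> x w) (return borel x))) \<partial>R x)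
          \<in> borel_measurable (completion (intensity P \<xi>)) \<and>
        (\<integral>\<^sup>+w. (\<integral>\<^sup>+x. ennreal (f (x, \<xi> w)) \<partial>\<xi> w) \<partial>P) =
        (\<integral>\<^sup>+x. (\<integral>\<^sup>+w. ennreal (f (x, measure_add (\<eta> x w) (return borel x))) \<partial>R x)
           \<partial>intensity P \<xi>))"

definition d_TV :: "'a::topological_space measure \<Rightarrow> 'a measure \<Rightarrow> ennreal" where
  "d_TV \<mu>1 \<mu>2 =
     (SUP A \<in> {A \<in> sets borel. emeasure \<mu>1 A < \<infinity> \<and> emeasure \<mu>2 A < \<infinity>}.
        ennreal \<bar>measure \<mu>1 A - measure \<mu>2 A\<bar>)"

definition TV_Lipschitz :: "('a::topological_space measure \<Rightarrow> real) set" where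
  "TV_Lipschitz =
     {h \<in> borel_measurable finite_counting_space.
        \<forall>\<omega>1\<in>finite_counting_measures. \<forall>\<omega>2\<in>finite_counting_measures.
          ennreal \<bar>h \<omega>1 - h \<omega>2\<bar> \<le> d_TV \<omega>1 \<omega>2}"

text \<open>
  The functions \<open>h\<close> are meaningful on finite counting measures only. Integrating over the event
  that the process is finite changes nothing for a finite point process, and makes the expectation
  well-defined also for a process that is only almost surely finite, such as a Poisson process
  with finite intensity measure.
\<close>

definition d_KR ::
    "'w measure \<Rightarrow> ('w \<Rightarrow> 'a::topological_space measure) \<Rightarrow>
     'v measure \<Rightarrow> ('v \<Rightarrow> 'a measure) \<Rightarrow> ennreal" where
  "d_KR P \<xi> Q \<zeta> =
     (SUP h \<in> TV_Lipschitz.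
        ennreal \<bar>(LINT w:{w\<in>space P. \<xi> w \<in> finite_counting_measures}|P. h (\<xi> w)) -
                 (LINT w:{w\<in>space Q. \<zeta> w \<in> finite_counting_measures}|Q. h (\<zeta> w))\<bar>)"

end

theory Submission
  imports Defs
begin

text \<open>
  The proof interpolates between the two processes instead of solving a Stein equation.  Let \<open>h\<close> be
  Lipschitz and let \<open>\<psi> t\<close> be the mean of \<open>h\<close> at the sum of a \<open>t\<close>-thinning of \<open>\<xi>\<close> and an independent \<open>(1 - t)\<close>-thinning
  of \<open>\<zeta>\<close>.  Then \<open>\<psi> 1\<close> is the mean of \<open>h\<close> at \<open>\<xi>\<close> and \<open>\<psi> 0\<close> its mean at \<open>\<zeta>\<close>, and the claim follows from a bound on the
  derivative of \<open>\<psi>\<close>.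

  Write \<open>v x \<omega>\<close> for the mean change of \<open>h\<close> caused by adding the point \<open>x\<close> to the sum of a \<open>t\<close>-thinning of \<open>\<omega>\<close> and the
  thinned Poisson points.  Moving \<open>t\<close> upwards lets points of \<open>\<xi>\<close> in and points of \<open>\<zeta>\<close> out.  By Russo's formula
  (\<open>has_real_derivative_thin\<close>) the first effect is the mean of the sum of \<open>v x (\<xi> - \<delta> x)\<close> over the points \<open>x\<close> of \<open>\<xi>\<close>.
  For the second effect the Mecke formula (\<open>mecke\<close>), derived here from the Poisson distribution and the
  independence of the counts, replaces the sum over the points of \<open>\<zeta>\<close> by the integral of the mean of
  \<open>v x \<xi>\<close> with respect to \<open>M\<close>.  Lemma \<open>stein_bound\<close> states the result.

  The sum over the points of \<open>\<xi>\<close> is the integral of the mean of \<open>v x\<close> at the reduced Palm version with respect to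
  the intensity \<open>L\<close> (\<open>palm_points\<close>).  Replacing the Palm version by \<open>\<xi>\<close> costs at most twice the mean mass of
  the symmetric difference of the coupled processes, because \<open>v x\<close> is bounded by one and two distinct
  configurations differ in at least one point (\<open>coupling_bound\<close>).  What remains is the difference of the integrals
  of \<open>v x \<xi>\<close> with respect to \<open>L\<close> and to \<open>M\<close>.  Here \<open>\<bar>v\<bar> \<le> 1\<close> alone would give twice the distance of \<open>L\<close> and \<open>M\<close>.  But
  \<open>v x \<omega> - v y \<omega>\<close> compares configurations with one displaced point, whose total variation distance is at most one, so \<open>v\<close>
  also oscillates by at most one in \<open>x\<close>, and a Hahn decomposition yields the constant one (\<open>integral_diff_le_d_TV\<close>).

  The argument takes place on finite multisets.  A finite counting measure on a second countable T1 space is the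
  counting measure of a multiset, and both carry the sigma-algebra generated by the counts.
\<close>

section \<open>Independent thinning of a finite multiset\<close>

text \<open>
  The fold over the points is the recursion that decides, point by point, whether the point is kept
  (probability \<open>t\<close>) or discarded (probability \<open>1 - t\<close>).  Folding functionals instead of a probability
  measure on submultisets makes the result a polynomial in \<open>t\<close>, defined for every real \<open>t\<close>.
\<close>

definition thin_step :: "real \<Rightarrow> 'a \<Rightarrow> (('a multiset \<Rightarrow> real) \<Rightarrow> real) \<Rightarrow> ('a multiset \<Rightarrow> real) \<Rightarrow> real" where
  "thin_step t x \<Phi> = (\<lambda>g. t * \<Phi> (\<lambda>K. g (add_mset x K)) + (1 - t) * \<Phi> g)"

text \<open>
  For \<open>t \<in> {0..1}\<close> this is the mean of \<open>g\<close> over the random submultiset of \<open>M\<close> that keeps every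
  point independently with probability \<open>t\<close>.
\<close>

definition thin :: "real \<Rightarrow> 'a multiset \<Rightarrow> ('a multiset \<Rightarrow> real) \<Rightarrow> real" where
  "thin t M = fold_mset (thin_step t) (\<lambda>g. g {#}) M"

text \<open>
  The decisions on two points may be taken in either order, hence thinning depends on the multiset only.
\<close>

lemma comp_fun_commute_thin_step: "comp_fun_commute (thin_step t)"
proof
  show "thin_step t y \<circ> thin_step t x = thin_step t x \<circ> thin_step t y" for x y :: 'a
    by (intro ext) (simp add: thin_step_def add_mset_commute algebra_simps)
qed

lemma thin_empty [simp]: "thin t {#} g = g {#}"
  by (simp add: thin_def)

lemma thin_add_mset [simp]:
  "thin t (add_mset x M) g = t * thin t M (\<lambda>K. g (add_mset x K)) + (1 - t) * thin t M g"
proof -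
  interpret comp_fun_commute "thin_step t :: 'a \<Rightarrow> _" by (rule comp_fun_commute_thin_step)
  show ?thesis by (simp add: thin_def) (simp add: thin_step_def)
qed

lemma thin_diff: "thin t M (\<lambda>K. f K - g K) = thin t M f - thin t M g"
proof (induction M arbitrary: f g)
  case (add x M)
  then show ?case by (simp only: thin_add_mset) (simp add: algebra_simps)
qed simp

lemma thin_uminus: "thin t M (\<lambda>K. - g K) = - thin t M g"
  by (induction M arbitrary: g) (simp_all add: algebra_simps)

lemma thin_1 [simp]: "thin 1 M g = g M"
  by (induction M arbitrary: g) simp_all

lemma thin_0 [simp]: "thin 0 M g = g {#}"
  by (induction M arbitrary: g) simp_all

text \<open>
  For \<open>t \<in> {0..1}\<close> each step of the recursion is a convex combination.  Only submultisets of \<open>M\<close> matter,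
  which is what makes functions of linear growth integrable after thinning.
\<close>

lemma abs_thin_le:
  assumes t: "t \<in> {0..1}" and g: "\<And>K. K \<subseteq># M \<Longrightarrow> \<bar>g K\<bar> \<le> c"
  shows "\<bar>thin t M g\<bar> \<le> c"
  using g
proof (induction M arbitrary: g)
  case (add x M)
  have 1: "\<bar>thin t M (\<lambda>K. g (add_mset x K))\<bar> \<le> c"
    by (intro add.IH add.prems) simp
  have 2: "\<bar>thin t M g\<bar> \<le> c"
    by (intro add.IH add.prems) (meson mset_subset_eq_add_right subset_mset.trans multi_psub_of_add_self subset_mset.less_imp_le)
  have "\<bar>thin t (add_mset x M) g\<bar> \<le> t * \<bar>thin t M (\<lambda>K. g (add_mset x K))\<bar> + (1 - t) * \<bar>thin t M g\<bar>"
    using t by (auto intro!: order.trans[OF abs_triangle_ineq] simp: abs_mult)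
  also have "\<dots> \<le> t * c + (1 - t) * c"
    using t 1 2 by (intro add_mono mult_left_mono) auto
  finally show ?case by (simp add: algebra_simps)
qed auto

text \<open>
  Russo's formula: raising the retention probability of one point \<open>x\<close> changes the mean at the rate at
  which \<open>g\<close> reacts to adding \<open>x\<close> to the thinning of the other points, and by the chain rule the
  contributions of all points add up.  The function \<open>g t\<close> may itself move with \<open>t\<close>; this is needed because
  the Poisson part of the interpolation is hidden in it.
\<close>

lemma has_real_derivative_thin:
  assumes "\<And>K. ((\<lambda>t. g t K) has_real_derivative g' K) (at t within S)"
  shows "((\<lambda>t. thin t M (g t)) has_real_derivative
           thin t M g' + (\<Sum>x\<in>#M. thin t (M - {#x#}) (\<lambda>K. g t (add_mset x K) - g t K)))
         (at t within S)"
  using assms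
proof (induction M arbitrary: g g')
  case (add x M)
  let ?D = "\<lambda>y K. g t (add_mset y K) - g t K"
  have *: "thin t (add_mset x M - {#y#}) (?D y) =
      t * thin t (M - {#y#}) (\<lambda>K. g t (add_mset x (add_mset y K)) - g t (add_mset x K))
      + (1 - t) * thin t (M - {#y#}) (?D y)" if "y \<in># M" for y
    using that by (simp add: add_mset_commute)
  have **: "(\<Sum>y\<in>#M. thin t (add_mset x M - {#y#}) (?D y)) =
      t * (\<Sum>y\<in>#M. thin t (M - {#y#}) (\<lambda>K. g t (add_mset x (add_mset y K)) - g t (add_mset x K)))
      + (1 - t) * (\<Sum>y\<in>#M. thin t (M - {#y#}) (?D y))"
    unfolding sum_mset_distrib_left sum_mset.distrib[symmetric]
    by (rule arg_cong[where f = sum_mset], rule image_mset_cong) (rule *)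
  show ?case
    unfolding thin_add_mset image_mset_add_mset sum_mset.add_mset **
    by (rule derivative_eq_intros add.IH[of "\<lambda>t. g t"] add.IH[of "\<lambda>t K. g t (add_mset x K)"] add.prems refl)+
       (simp add: thin_diff algebra_simps add_mset_commute)
qed simp

section \<open>The measurable space of finite multisets\<close>

definition counts :: "'a set \<Rightarrow> 'a multiset \<Rightarrow> nat" where
  "counts A M = size (filter_mset (\<lambda>x. x \<in> A) M)"

lemma counts_empty [simp]: "counts A {#} = 0"
  by (simp add: counts_def)

lemma counts_add_mset [simp]: "counts A (add_mset x M) = of_bool (x \<in> A) + counts A M"
  by (simp add: counts_def)

lemma counts_union [simp]: "counts A (M + N) = counts A M + counts A N"
  by (simp add: counts_def)

lemma counts_UNIV [simp]: "counts UNIV M = size M"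
  by (simp add: counts_def)

lemma counts_remove: "counts A (M - {#x#}) = counts A M - of_bool (x \<in># M \<and> x \<in> A)"
proof (cases "x \<in># M")
  case True
  then obtain N where "M = add_mset x N" by (meson mset_add)
  then show ?thesis by simp
qed (simp add: diff_single_trivial)

lemma counts_eq_sum_mset: "of_nat (counts A M) = (\<Sum>x\<in>#M. indicator A x :: 'b::semiring_1)"
  by (induction M) (auto simp: indicator_def of_bool_def)

text \<open>
  The finest information about a random multiset that is used is the number of its points in each
  Borel set, so this is the evaluation sigma-algebra carried over from counting measures.
\<close>

definition multiset_space :: "'a::topological_space multiset measure" where
  "multiset_space = sigma UNIV {counts A -` {k} | A k. A \<in> sets borel}"

lemma space_multiset_space [simp]: "space multiset_space = UNIV"
  by (simp add: multiset_space_def space_measure_of_conv)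

lemma sets_multiset_space:
  "sets (multiset_space :: 'a::topological_space multiset measure) =
     sigma_sets UNIV {counts A -` {k} | A k. A \<in> sets borel}"
  by (simp add: multiset_space_def)

lemma measurable_counts [measurable]:
  assumes "A \<in> sets borel"
  shows "counts A \<in> measurable multiset_space (count_space UNIV)"
proof (rule measurable_count_space_eq2_countable[THEN iffD2], intro conjI ballI)
  show "counts A -` {k} \<inter> space multiset_space \<in> sets multiset_space" for k
    using assms by (auto simp: sets_multiset_space intro!: sigma_sets.Basic)
qed auto

lemma measurable_multiset_spaceI:
  fixes f :: "'w \<Rightarrow> 'a::topological_space multiset"
  assumes "\<And>A. A \<in> sets borel \<Longrightarrow> (\<lambda>w. counts A (f w)) \<in> measurable N (count_space UNIV)"
  shows "f \<in> measurable N multiset_space"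
  unfolding multiset_space_def
proof (rule measurable_measure_of)
  fix y :: "'a multiset set" assume "y \<in> {counts A -` {k} | A k. A \<in> sets borel}"
  then obtain A k where y: "y = counts A -` {k}" and A: "A \<in> sets borel" by blast
  have "(\<lambda>w. counts A (f w)) -` {k} \<inter> space N \<in> sets N"
    using measurable_sets[OF assms[OF A], of "{k}"] by simp
  then show "f -` y \<inter> space N \<in> sets N"
    by (simp add: y vimage_def)
qed auto

lemma measurable_add_mset [measurable (raw)]:
  assumes [measurable]: "f \<in> measurable N borel" "g \<in> measurable N multiset_space"
  shows "(\<lambda>w. add_mset (f w) (g w)) \<in> measurable N multiset_space"
  by (rule measurable_multiset_spaceI) simp

lemma measurable_union_mset [measurable (raw)]:
  assumes [measurable]: "f \<in> measurable N multiset_space" "g \<in> measurable N multiset_space"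
  shows "(\<lambda>w. f w + g w) \<in> measurable N multiset_space"
  by (rule measurable_multiset_spaceI) simp

lemma measurable_size_mset [measurable (raw)]:
  assumes [measurable]: "f \<in> measurable N multiset_space"
  shows "(\<lambda>w. size (f w)) \<in> measurable N (count_space UNIV)"
proof -
  have "(\<lambda>w. counts UNIV (f w)) \<in> measurable N (count_space UNIV)" by measurable
  then show ?thesis by simp
qed

text \<open>
  A finite set is closed in a T1 space, so a point outside a multiset is separated from it by a basis
  element.  A countable basis turns membership into countably many conditions on counts.
\<close>

lemma mem_mset_iff_basis:
  fixes x :: "'a::t1_space"
  assumes "topological_basis \<B>"
  shows "x \<in># M \<longleftrightarrow> (\<forall>b\<in>\<B>. x \<in> b \<longrightarrow> counts b M \<noteq> 0)"
proof
  assume "x \<in># M"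
  then show "\<forall>b\<in>\<B>. x \<in> b \<longrightarrow> counts b M \<noteq> 0" by (auto simp: counts_def)
next
  assume *: "\<forall>b\<in>\<B>. x \<in> b \<longrightarrow> counts b M \<noteq> 0"
  show "x \<in># M"
  proof (rule ccontr)
    assume "x \<notin># M"
    moreover have "open (- set_mset M)" by (simp add: finite_imp_closed open_Compl)
    ultimately obtain b where "b \<in> \<B>" "x \<in> b" "b \<subseteq> - set_mset M"
      using topological_basisE[OF assms, of "- set_mset M" x] by auto
    with * have "counts b M \<noteq> 0" by blast
    then obtain y where "y \<in># M" "y \<in> b" by (induction M) auto
    with \<open>b \<subseteq> - set_mset M\<close> show False by auto
  qed
qed

lemma pred_mem_mset [measurable (raw)]:
  fixes f :: "'w \<Rightarrow> 'a::{second_countable_topology, t1_space}"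
  assumes [measurable]: "f \<in> measurable N borel" "g \<in> measurable N multiset_space"
  shows "Measurable.pred N (\<lambda>w. f w \<in># g w)"
proof -
  obtain \<B> :: "'a set set" where \<B>: "countable \<B>" "topological_basis \<B>"
    using ex_countable_basis by auto
  have [measurable]: "b \<in> sets borel" if "b \<in> \<B>" for b
    using topological_basis_open[OF \<B>(2)] that by simp
  have [measurable]: "Measurable.pred N (\<lambda>w. f w \<in> b \<longrightarrow> counts b (g w) \<noteq> 0)" if "b \<in> \<B>" for b
    using that by measurable
  show ?thesis
    unfolding mem_mset_iff_basis[OF \<B>(2)]
    using \<B>(1) by measurable
qed

lemma measurable_remove_mset [measurable (raw)]:
  fixes f :: "'w \<Rightarrow> 'a::{second_countable_topology, t1_space}"
  assumes [measurable]: "f \<in> measurable N borel" "g \<in> measurable N multiset_space"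
  shows "(\<lambda>w. g w - {#f w#}) \<in> measurable N multiset_space"
  by (rule measurable_multiset_spaceI) (simp add: counts_remove)

text \<open>
  The counting measure of \<open>M\<close>, written with a density so that it is a measure by construction and
  integrates functions by summation over the points.
\<close>

definition mset_measure :: "'a::topological_space multiset \<Rightarrow> 'a measure" where
  "mset_measure M = distr (density (count_space UNIV) (\<lambda>x. of_nat (count M x))) borel (\<lambda>x. x)"

lemma sets_mset_measure [simp, measurable_cong]: "sets (mset_measure M) = sets borel"
  by (simp add: mset_measure_def)

lemma space_mset_measure [simp]: "space (mset_measure M) = UNIV"
  by (simp add: mset_measure_def)

lemma sum_mset_eq_sum_count:
  "(\<Sum>x\<in>#M. f x) = (\<Sum>x\<in>set_mset M. of_nat (count M x) * f x :: 'b::comm_semiring_1)"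
proof -
  have "(\<Sum>x\<in>#M. f x) = (\<Sum>x\<in>S. of_nat (count M x) * f x)"
    if "finite S" "set_mset M \<subseteq> S" for S
    using that(2)
  proof (induction M)
    case (add y M)
    have "(\<Sum>x\<in>S. of_nat (count (add_mset y M) x) * f x) =
        (\<Sum>x\<in>S. of_nat (count M x) * f x + (if x = y then f x else 0))"
      by (intro sum.cong) (auto simp: algebra_simps)
    also have "\<dots> = (\<Sum>x\<in>S. of_nat (count M x) * f x) + f y"
      using add.prems that(1) by (simp add: sum.distrib)
    finally show ?case using add by (simp add: add.commute)
  qed simp
  then show ?thesis by blast
qed

lemma nn_integral_mset_measure:
  assumes [measurable]: "f \<in> borel_measurable borel"
  shows "(\<integral>\<^sup>+x. f x \<partial>mset_measure M) = (\<Sum>x\<in>#M. f x)"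
proof -
  have "(\<integral>\<^sup>+x. f x \<partial>mset_measure M) = (\<integral>\<^sup>+x. of_nat (count M x) * f x \<partial>count_space UNIV)"
    by (simp add: mset_measure_def nn_integral_distr nn_integral_density)
  also have "\<dots> = (\<Sum>x\<in>set_mset M. of_nat (count M x) * f x)"
    by (intro nn_integral_count_space') (auto simp: not_in_iff)
  finally show ?thesis by (simp add: sum_mset_eq_sum_count)
qed

lemma emeasure_mset_measure:
  assumes "A \<in> sets borel"
  shows "emeasure (mset_measure M) A = of_nat (counts A M)"
  using nn_integral_mset_measure[of "indicator A" M] assms
  by (simp add: counts_eq_sum_mset)

text \<open>
  Summation over the points is integration against a kernel.  After division by one more than the
  number of points it becomes a sub-probability kernel, for which measurability of integrals is known.
\<close>

lemma borel_measurable_nn_sum_mset [measurable (raw)]: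
  fixes F :: "'w \<Rightarrow> 'a::topological_space \<Rightarrow> ennreal"
  assumes [measurable]: "(\<lambda>(w, x). F w x) \<in> borel_measurable (N \<Otimes>\<^sub>M borel)"
    "Z \<in> measurable N multiset_space"
  shows "(\<lambda>w. \<Sum>x\<in>#Z w. F w x) \<in> borel_measurable N"
proof -
  let ?r = "\<lambda>w. ennreal (1 / Suc (size (Z w)))"
  have le: "ennreal (1 / Suc (size M)) * of_nat (size M) \<le> 1" for M :: "'a multiset"
    by (simp add: ennreal_of_nat_eq_real_of_nat flip: ennreal_mult)
  have K: "(\<lambda>w. scale_measure (?r w) (mset_measure (Z w))) \<in> measurable N (subprob_algebra borel)"
    by (rule measurable_subprob_algebra)
       (auto intro!: subprob_spaceI simp: emeasure_mset_measure le space_scale_measure simp del: of_nat_Suc)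
  have "(\<lambda>w. of_nat (Suc (size (Z w))) *
      (\<integral>\<^sup>+x. F w x \<partial>scale_measure (?r w) (mset_measure (Z w)))) \<in> borel_measurable N"
    using nn_integral_measurable_subprob_algebra2[OF assms(1) K] by measurable
  also have "(\<lambda>w. of_nat (Suc (size (Z w))) *
      (\<integral>\<^sup>+x. F w x \<partial>scale_measure (?r w) (mset_measure (Z w)))) \<in> borel_measurable N \<longleftrightarrow>
     (\<lambda>w. \<Sum>x\<in>#Z w. F w x) \<in> borel_measurable N"
  proof (rule measurable_cong)
    fix w assume w: "w \<in> space N"
    have [measurable]: "F w \<in> borel_measurable borel"
      using measurable_compose[OF measurable_Pair1'[OF w] assms(1)] by simp
    have "of_nat (Suc (size (Z w))) * (\<integral>\<^sup>+x. F w x \<partial>scale_measure (?r w) (mset_measure (Z w))) =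
        of_nat (Suc (size (Z w))) * ?r w * (\<Sum>x\<in>#Z w. F w x)"
      by (simp add: nn_integral_scale_measure nn_integral_mset_measure mult.assoc del: of_nat_Suc)
    also have "of_nat (Suc (size (Z w))) * ?r w = 1"
      by (simp add: ennreal_of_nat_eq_real_of_nat del: of_nat_Suc flip: ennreal_mult)
    finally show "of_nat (Suc (size (Z w))) *
        (\<integral>\<^sup>+x. F w x \<partial>scale_measure (?r w) (mset_measure (Z w))) = (\<Sum>x\<in>#Z w. F w x)"
      by simp
  qed
  finally show ?thesis .
qed

lemma ennreal_sum_mset:
  "(\<Sum>x\<in>#M. ennreal (f x)) = ennreal (\<Sum>x\<in>#M. max 0 (f x))"
proof (induction M)
  case (add x M)
  have "(\<Sum>x\<in>#M. max 0 (f x)) \<ge> 0" by (induction M) auto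
  with add show ?case
    by (simp add: max_def ennreal_neg flip: ennreal_plus)
qed simp

lemma borel_measurable_sum_mset [measurable (raw)]:
  fixes F :: "'w \<Rightarrow> 'a::topological_space \<Rightarrow> real"
  assumes [measurable]: "(\<lambda>(w, x). F w x) \<in> borel_measurable (N \<Otimes>\<^sub>M borel)"
    "Z \<in> measurable N multiset_space"
  shows "(\<lambda>w. \<Sum>x\<in>#Z w. F w x) \<in> borel_measurable N"
proof -
  have nn: "(\<Sum>x\<in>#M. max 0 (f x)) \<ge> (0::real)" for M :: "'a multiset" and f
    by (induction M) auto
  have sum: "(\<Sum>x\<in>#M. f x) =
      enn2real (\<Sum>x\<in>#M. ennreal (f x)) - enn2real (\<Sum>x\<in>#M. ennreal (- f x))"
    for M :: "'a multiset" and f :: "'a \<Rightarrow> real"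
  proof -
    have "(\<Sum>x\<in>#M. f x) = (\<Sum>x\<in>#M. max 0 (f x)) - (\<Sum>x\<in>#M. max 0 (- f x))"
      by (induction M) (simp_all add: max_def)
    then show ?thesis
      unfolding ennreal_sum_mset by (simp only: enn2real_ennreal[OF nn])
  qed
  have "(\<lambda>w. enn2real (\<Sum>x\<in>#Z w. ennreal (F w x)) - enn2real (\<Sum>x\<in>#Z w. ennreal (- F w x)))
      \<in> borel_measurable N"
    by measurable
  then show ?thesis by (subst sum)
qed

text \<open>
  In the recursion of the thinning any point of \<open>M\<close> may come first.  Averaging over that choice gives a
  recursion that does not pick a point, and therefore preserves measurability in \<open>M\<close>.
\<close>

lemma thin_average:
  assumes "M \<noteq> {#}"
  shows "thin t M g = (\<Sum>x\<in>#M. t * thin t (M - {#x#}) (\<lambda>K. g (add_mset x K)) +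
           (1 - t) * thin t (M - {#x#}) g) / size M"
proof -
  have "t * thin t (M - {#x#}) (\<lambda>K. g (add_mset x K)) + (1 - t) * thin t (M - {#x#}) g = thin t M g"
    if "x \<in># M" for x
    using thin_add_mset[of t x "M - {#x#}" g] that by simp
  then have "(\<Sum>x\<in>#M. t * thin t (M - {#x#}) (\<lambda>K. g (add_mset x K)) +
           (1 - t) * thin t (M - {#x#}) g) = (\<Sum>x\<in>#M. thin t M g)"
    by (intro arg_cong[where f = sum_mset] image_mset_cong) auto
  with assms show ?thesis by (simp add: sum_mset_constant)
qed

text \<open>
  Induction over the size of \<open>M\<close> by means of the averaged recursion.  The points already kept are collected in an
  additional multiset \<open>K\<close>, so that all stages of the induction live on the same product space.
\<close>

lemma borel_measurable_thin:
  fixes G :: "'p \<Rightarrow> 'a::{second_countable_topology, t1_space} multiset \<Rightarrow> real"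
  assumes G [measurable]: "(\<lambda>(p, K). G p K) \<in> borel_measurable (N \<Otimes>\<^sub>M multiset_space)"
  shows "(\<lambda>(p, M). thin t M (G p)) \<in> borel_measurable (N \<Otimes>\<^sub>M multiset_space)"
proof -
  let ?MS = "multiset_space :: 'a multiset measure"
  define W where
    "W n z = (case z of (p, K, M) \<Rightarrow> if size M = n then thin t M (\<lambda>K'. G p (K + K')) else 0)"
    for n :: nat and z :: "'p \<times> 'a multiset \<times> 'a multiset"
  have W [measurable]: "W n \<in> borel_measurable (N \<Otimes>\<^sub>M ?MS \<Otimes>\<^sub>M ?MS)" for n
  proof (induction n)
    case 0
    have "W 0 = (\<lambda>z. if size (snd (snd z)) = 0 then G (fst z) (fst (snd z)) else 0)"
      by (auto simp: W_def fun_eq_iff)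
    also have "\<dots> \<in> borel_measurable (N \<Otimes>\<^sub>M ?MS \<Otimes>\<^sub>M ?MS)" by measurable
    finally show ?case .
  next
    case (Suc n)
    note [measurable] = Suc
    define R where "R z = (if size (snd (snd z)) = Suc n then
        (\<Sum>x\<in>#snd (snd z). t * W n (fst z, add_mset x (fst (snd z)), snd (snd z) - {#x#}) +
          (1 - t) * W n (fst z, fst (snd z), snd (snd z) - {#x#})) / Suc n
        else 0)" for z
    have "W (Suc n) (p, K, M) = R (p, K, M)" for p K M
    proof (cases "size M = Suc n")
      case True
      then have "M \<noteq> {#}" by auto
      have "(\<Sum>x\<in>#M. t * thin t (M - {#x#}) (\<lambda>K'. G p (K + add_mset x K')) +
          (1 - t) * thin t (M - {#x#}) (\<lambda>K'. G p (K + K'))) =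
         (\<Sum>x\<in>#M. t * W n (p, add_mset x K, M - {#x#}) + (1 - t) * W n (p, K, M - {#x#}))"
        using True
        by (intro arg_cong[where f = sum_mset] image_mset_cong) (simp add: W_def size_Diff_singleton)
      with True thin_average[OF \<open>M \<noteq> {#}\<close>, of t "\<lambda>K'. G p (K + K')"]
      show ?thesis by (simp add: R_def) (simp add: W_def)
    qed (simp add: W_def R_def)
    then have "W (Suc n) = R" by auto
    moreover have "R \<in> borel_measurable (N \<Otimes>\<^sub>M ?MS \<Otimes>\<^sub>M ?MS)"
      unfolding R_def by measurable
    ultimately show ?case by simp
  qed
  have "(\<lambda>z. W (size (snd z)) (fst z, {#}, snd z)) \<in> borel_measurable (N \<Otimes>\<^sub>M ?MS)"
    by (rule measurable_compose_countable[where f = "\<lambda>n z. W n (fst z, {#}, snd z)"]) measurable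
  then show ?thesis by (simp add: W_def case_prod_beta')
qed

section \<open>Poisson vectors and mixtures of measures\<close>

text \<open>
  The identity \<open>k * p k = l * p (k - 1)\<close> for the weights \<open>p\<close> of the Poisson distribution with mean \<open>l\<close>, summed over \<open>k\<close>.
  This is the Mecke formula for a space with one point.
\<close>

lemma nn_integral_poisson_shift:
  fixes \<mu> :: "nat measure" and g :: "nat \<Rightarrow> ennreal"
  assumes sets: "sets \<mu> = UNIV" and "0 \<le> l"
    and \<mu>: "\<And>k. emeasure \<mu> {k} = ennreal (l ^ k / fact k * exp (- l))"
  shows "(\<integral>\<^sup>+k. of_nat k * g (k - 1) \<partial>\<mu>) = ennreal l * (\<integral>\<^sup>+k. g k \<partial>\<mu>)"
proof -
  let ?p = "\<lambda>k. ennreal (l ^ k / fact k * exp (- l))"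
  have "\<mu> = density (count_space UNIV) ?p"
  proof (rule measure_eqI_countable[of _ UNIV])
    show "emeasure \<mu> {k} = emeasure (density (count_space UNIV) ?p) {k}" for k
      by (simp add: \<mu> emeasure_density)
  qed (auto simp: sets)
  then have *: "(\<integral>\<^sup>+k. f k \<partial>\<mu>) = (\<Sum>k. ?p k * f k)" for f
    by (simp add: nn_integral_density nn_integral_count_space_nat)
  have shift: "?p (Suc k) * (of_nat (Suc k) * g k) = ennreal l * (?p k * g k)" for k
  proof -
    have "?p (Suc k) * of_nat (Suc k) = ennreal (l ^ Suc k / fact (Suc k) * exp (- l) * real (Suc k))"
      using \<open>0 \<le> l\<close> by (simp only: ennreal_of_nat_eq_real_of_nat) (rule ennreal_mult[symmetric]; simp)
    also have "l ^ Suc k / fact (Suc k) * exp (- l) * real (Suc k) = l * (l ^ k / fact k * exp (- l))"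
      by (simp del: of_nat_Suc)
    also have "ennreal \<dots> = ennreal l * ?p k"
      using \<open>0 \<le> l\<close> by (intro ennreal_mult) simp_all
    finally show ?thesis by (simp add: mult.assoc[symmetric])
  qed
  have "(\<lambda>k. ?p (Suc k) * (of_nat (Suc k) * g (Suc k - 1))) sums (\<Sum>k. ennreal l * (?p k * g k))"
    unfolding diff_Suc_1 shift by (rule summable_sums) (rule summableI)
  from sums_Suc[OF this] show ?thesis
    by (simp add: * sums_iff ennreal_suminf_cmult)
qed

text \<open>
  By independence the one-dimensional shift can be carried out in coordinate \<open>j\<close> while the other
  coordinates are held fixed.
\<close>

lemma (in prob_space) nn_integral_indep_poisson_shift:
  fixes X :: "'i \<Rightarrow> 'a \<Rightarrow> nat" and \<Phi> :: "('i \<Rightarrow> nat) \<Rightarrow> ennreal"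
  assumes I: "finite I" "j \<in> I" and ind: "indep_vars (\<lambda>_. count_space UNIV) X I"
    and l: "0 \<le> l" and X: "\<And>k. prob {w \<in> space M. X j w = k} = l ^ k / fact k * exp (- l)"
  shows "(\<integral>\<^sup>+w. of_nat (X j w) * \<Phi> ((\<lambda>i\<in>I. X i w)(j := X j w - 1)) \<partial>M) =
    ennreal l * (\<integral>\<^sup>+w. \<Phi> (\<lambda>i\<in>I. X i w) \<partial>M)"
proof -
  have rv [measurable]: "X i \<in> measurable M (count_space UNIV)" if "i \<in> I" for i
    using ind that by (simp add: indep_vars_def)
  define \<mu> where "\<mu> i = distr M (count_space UNIV) (if i \<in> I then X i else (\<lambda>_. 0))" for i
  have rv' [measurable]: "(if i \<in> I then X i else (\<lambda>_. 0)) \<in> measurable M (count_space UNIV)" for i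
    using rv by simp
  have \<mu>_prob: "prob_space (\<mu> i)" for i
    unfolding \<mu>_def by (rule prob_space_distr) simp
  interpret \<mu>: product_sigma_finite \<mu>
    by (simp add: product_sigma_finite_def prob_space_imp_sigma_finite \<mu>_prob)
  have sets_\<mu> [measurable_cong, simp]: "sets (\<mu> i) = sets (count_space UNIV)" for i
    by (simp add: \<mu>_def)
  have sets_PiM: "sets (PiM I \<mu>) = Pow (I \<rightarrow>\<^sub>E UNIV)" if "finite I" for I
  proof -
    have "sets (PiM I \<mu>) = sets (PiM I (\<lambda>_. count_space UNIV :: nat measure))"
      by (intro sets_PiM_cong) auto
    then show ?thesis using that by (simp add: count_space_PiM_finite)
  qed
  have space_\<mu>: "space (\<mu> i) = UNIV" for i by (simp add: \<mu>_def)
  have meas: "f \<in> borel_measurable (PiM I \<mu>)" if "finite I" for f :: "('i \<Rightarrow> nat) \<Rightarrow> ennreal" and I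
    by (rule measurableI) (auto simp: sets_PiM[OF that] space_PiM space_\<mu>)
  have "distr M (\<Pi>\<^sub>M i\<in>I. count_space UNIV) (\<lambda>w. \<lambda>i\<in>I. X i w) = (\<Pi>\<^sub>M i\<in>I. distr M (count_space UNIV) (X i))"
    using I ind by (subst indep_vars_iff_distr_eq_PiM'[symmetric]) (auto simp: rv)
  also have "\<dots> = PiM I \<mu>"
    by (intro PiM_cong) (auto simp: \<mu>_def)
  finally have D: "PiM I \<mu> = distr M (\<Pi>\<^sub>M i\<in>I. count_space UNIV) (\<lambda>w. \<lambda>i\<in>I. X i w)" ..
  have law: "(\<integral>\<^sup>+w. f (\<lambda>i\<in>I. X i w) \<partial>M) = (\<integral>\<^sup>+v. f v \<partial>PiM I \<mu>)" for f
    unfolding D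
  proof (rule nn_integral_distr[symmetric])
    show "(\<lambda>w. \<lambda>i\<in>I. X i w) \<in> measurable M (\<Pi>\<^sub>M i\<in>I. count_space UNIV)"
      by (rule measurable_restrict) (rule rv)
    show "f \<in> borel_measurable (distr M (\<Pi>\<^sub>M i\<in>I. count_space UNIV) (\<lambda>w. \<lambda>i\<in>I. X i w))"
      using meas[OF I(1), of f] unfolding D .
  qed
  define J where "J = I - {j}"
  have J: "finite J" "j \<notin> J" "I = insert j J" using I by (auto simp: J_def)
  have \<mu>_j: "emeasure (\<mu> j) {k} = ennreal (l ^ k / fact k * exp (- l))" for k
    using X[of k] I by (simp add: \<mu>_def emeasure_distr rv vimage_def Int_def conj_commute emeasure_eq_measure)
  have "(\<integral>\<^sup>+w. of_nat (X j w) * \<Phi> ((\<lambda>i\<in>I. X i w)(j := X j w - 1)) \<partial>M) =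
      (\<integral>\<^sup>+w. (\<lambda>v. of_nat (v j) * \<Phi> (v(j := v j - 1))) (\<lambda>i\<in>I. X i w) \<partial>M)"
    using I by simp
  also have "\<dots> = (\<integral>\<^sup>+v. \<integral>\<^sup>+k. of_nat k * \<Phi> (v(j := k - 1)) \<partial>\<mu> j \<partial>PiM J \<mu>)"
    unfolding law[of "\<lambda>v. of_nat (v j) * \<Phi> (v(j := v j - 1))"] unfolding J(3)
    by (subst \<mu>.product_nn_integral_insert[OF J(1,2)]) (simp_all add: meas J)
  also have "\<dots> = (\<integral>\<^sup>+v. ennreal l * (\<integral>\<^sup>+k. \<Phi> (v(j := k)) \<partial>\<mu> j) \<partial>PiM J \<mu>)"
    by (intro nn_integral_cong nn_integral_poisson_shift[OF _ l \<mu>_j, of "\<lambda>k. \<Phi> (_(j := k))"]) simp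
  also have "\<dots> = ennreal l * (\<integral>\<^sup>+v. \<Phi> v \<partial>PiM I \<mu>)"
    unfolding J(3) by (subst \<mu>.product_nn_integral_insert[OF J(1,2)])
      (simp_all add: meas J nn_integral_cmult)
  finally show ?thesis unfolding law[of \<Phi>] .
qed

text \<open>
  The mixture over \<open>P\<close> of the images of the measures \<open>K w\<close> under \<open>f w\<close>.  The measures \<open>K w\<close> may have any
  total mass, which is why this is not an instance of the probabilistic bind.
\<close>

lemma ex_mixture_measure:
  fixes K :: "'w \<Rightarrow> 'a measure" and f :: "'w \<Rightarrow> 'a \<Rightarrow> 'b"
  assumes f [measurable]: "\<And>w. f w \<in> measurable (K w) N"
    and meas: "\<And>F :: 'b \<Rightarrow> ennreal. F \<in> borel_measurable N \<Longrightarrow>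
      (\<lambda>w. \<integral>\<^sup>+x. F (f w x) \<partial>K w) \<in> borel_measurable P"
  obtains \<kappa> where "sets \<kappa> = sets N"
    "\<And>F. F \<in> borel_measurable N \<Longrightarrow> (\<integral>\<^sup>+z. F z \<partial>\<kappa>) = (\<integral>\<^sup>+w. \<integral>\<^sup>+x. F (f w x) \<partial>K w \<partial>P)"
proof -
  define L where "L F = (\<integral>\<^sup>+w. \<integral>\<^sup>+x. F (f w x) \<partial>K w \<partial>P)" for F :: "'b \<Rightarrow> ennreal"
  have L_suminf: "L (\<lambda>z. \<Sum>i. F i z) = (\<Sum>i. L (F i))"
    if [measurable]: "\<And>i. F i \<in> borel_measurable N" for F :: "nat \<Rightarrow> 'b \<Rightarrow> ennreal"
    unfolding L_def by (simp add: nn_integral_suminf meas)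
  define \<kappa> where "\<kappa> = measure_of (space N) (sets N) (\<lambda>E. L (indicator E))"
  have sets: "sets \<kappa> = sets N" by (simp add: \<kappa>_def)
  note sets [measurable_cong]
  have em: "emeasure \<kappa> E = L (indicator E)" if "E \<in> sets N" for E
  proof (rule emeasure_measure_of[OF \<kappa>_def])
    show "countably_additive (sets \<kappa>) (\<lambda>E. L (indicator E))"
    proof (rule countably_additiveI)
      fix A :: "nat \<Rightarrow> 'b set" assume A: "range A \<subseteq> sets \<kappa>" "disjoint_family A"
      then have "(\<Sum>i. L (indicator (A i))) = L (\<lambda>z. \<Sum>i. indicator (A i) z)"
        by (intro L_suminf[symmetric]) (auto simp: sets)
      also have "(\<lambda>z. \<Sum>i. indicator (A i) z :: ennreal) = indicator (\<Union> (range A))"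
        using A(2) by (auto simp: suminf_indicator)
      finally show "(\<Sum>i. L (indicator (A i))) = L (indicator (\<Union> (range A)))" .
    qed
  qed (use that sets.space_closed sets in \<open>auto simp: positive_def L_def\<close>)
  have "(\<integral>\<^sup>+z. F z \<partial>\<kappa>) = L F" if "F \<in> borel_measurable N" for F
  proof -
    from that have "F \<in> borel_measurable \<kappa>" by simp
    then show ?thesis
    proof (induction F rule: borel_measurable_induct)
      case (cong F G)
      have "L F = L G"
        unfolding L_def using cong(3) measurable_space[OF f] sets_eq_imp_space_eq[OF sets]
        by (intro nn_integral_cong) auto
      with cong show ?case by (simp cong: nn_integral_cong)
    next
      case (set A)
      then show ?case by (simp add: em sets)
    next
      case (mult F c)
      then show ?case by (simp add: L_def nn_integral_cmult meas)
    next
      case (add F G)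
      then show ?case by (simp add: L_def nn_integral_add meas)
    next
      case (seq U)
      have [measurable]: "U i \<in> borel_measurable N" for i using seq(1)[of i] by simp
      have "(\<integral>\<^sup>+z. (SUP i. U i z) \<partial>\<kappa>) = (SUP i. L (U i))"
        using seq by (simp add: nn_integral_monotone_convergence_SUP)
      also have "\<dots> = (\<integral>\<^sup>+w. (SUP i. \<integral>\<^sup>+x. U i (f w x) \<partial>K w) \<partial>P)"
        unfolding L_def using seq(3)
        by (intro nn_integral_monotone_convergence_SUP[symmetric])
           (auto simp: meas incseq_def le_fun_def intro!: nn_integral_mono)
      also have "\<dots> = L (\<lambda>z. SUP i. U i z)"
        unfolding L_def using seq(3)
        by (intro nn_integral_cong nn_integral_monotone_convergence_SUP[symmetric])
           (auto simp: incseq_def le_fun_def)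
      finally show ?case by (simp add: SUP_apply image_image)
    qed
  qed
  with sets show thesis by (intro that[of \<kappa>]) (auto simp: L_def)
qed

section \<open>The Mecke formula\<close>

text \<open>
  Prescribing finitely many counts gives a generator of the sigma-algebra that is stable under
  intersection, because two lists of conditions can be concatenated.
\<close>

definition cylinders :: "'a::topological_space multiset set set" where
  "cylinders = {{M. \<forall>i<n. counts (B i) M = k i} | B k (n::nat). \<forall>i<n. B i \<in> sets borel}"

lemma cylindersI:
  fixes n :: nat
  shows "(\<And>i. i < n \<Longrightarrow> B i \<in> sets borel) \<Longrightarrow> {M. \<forall>i<n. counts (B i) M = k i} \<in> cylinders"
  unfolding cylinders_def by (intro CollectI exI[of _ B] exI[of _ k] exI[of _ n]) auto

lemma cylindersE:
  assumes "C \<in> cylinders"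
  obtains B k n where "C = {M. \<forall>i<(n::nat). counts (B i) M = k i}" "\<And>i. i < n \<Longrightarrow> B i \<in> sets borel"
  using assms unfolding cylinders_def by (elim CollectE exE conjE) (rule that, assumption, simp)

lemma UNIV_in_cylinders: "UNIV \<in> cylinders"
  using cylindersI[of 0 "\<lambda>_. UNIV" "\<lambda>_. 0"] by simp

lemma cylinders_Int:
  assumes "C \<in> cylinders" "D \<in> cylinders"
  shows "C \<inter> D \<in> cylinders"
proof -
  obtain B k m where
    C: "C = {M. \<forall>i<(m::nat). counts (B i) M = k i}" "\<And>i. i < m \<Longrightarrow> B i \<in> sets borel"
    using assms(1) by (rule cylindersE) (rule that)
  obtain B' k' n where
    D: "D = {M. \<forall>i<(n::nat). counts (B' i) M = k' i}" "\<And>i. i < n \<Longrightarrow> B' i \<in> sets borel"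
    using assms(2) by (rule cylindersE) (rule that)
  let ?B = "\<lambda>i. if i < m then B i else B' (i - m)" and ?k = "\<lambda>i. if i < m then k i else k' (i - m)"
  have "(\<forall>i<m + n. counts (?B i) M = ?k i) \<longleftrightarrow>
      (\<forall>i<m. counts (B i) M = k i) \<and> (\<forall>i<n. counts (B' i) M = k' i)" (is "?l = ?r") for M
  proof
    assume l: ?l
    show ?r
    proof (intro conjI allI impI)
      show "counts (B i) M = k i" if "i < m" for i using l that by (auto dest: spec[of _ i])
      show "counts (B' i) M = k' i" if "i < n" for i using l that by (auto dest: spec[of _ "m + i"])
    qed
  qed auto
  then have "C \<inter> D = {M. \<forall>i<m + n. counts (?B i) M = ?k i}" unfolding C(1) D(1) by blast
  also have "\<dots> \<in> cylinders" using C(2) D(2) by (intro cylindersI) auto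
  finally show ?thesis .
qed

lemma sets_multiset_space_cylinders:
  "sets (multiset_space :: 'a::topological_space multiset measure) = sigma_sets UNIV cylinders"
proof (rule antisym)
  have "counts A -` {k} \<in> sigma_sets UNIV cylinders" if "A \<in> sets borel" for A :: "'a set" and k
  proof (rule sigma_sets.Basic)
    have "counts A -` {k} = {M. \<forall>i<Suc 0. counts A M = k}" by auto
    then show "counts A -` {k} \<in> cylinders"
      using cylindersI[of "Suc 0" "\<lambda>_. A" "\<lambda>_. k"] that by simp
  qed
  then show "sets (multiset_space :: 'a multiset measure) \<subseteq> sigma_sets UNIV cylinders"
    unfolding sets_multiset_space by (intro sigma_sets_mono) auto
  have "{M. \<forall>i<n. counts (B i) M = k i} \<in> sets multiset_space"
    if B: "\<forall>i<n. B i \<in> sets borel" for n :: nat and B :: "nat \<Rightarrow> 'a set" and k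
  proof -
    have [measurable]: "Measurable.pred multiset_space (\<lambda>M. counts (B i) M = k i)" if "i < n" for i
    proof -
      have [measurable]: "B i \<in> sets borel" using B that by simp
      show ?thesis by measurable
    qed
    have "{M \<in> space multiset_space. \<forall>i\<in>{..<n}. counts (B i) M = k i} \<in> sets multiset_space"
      by measurable
    then show ?thesis by (simp add: Ball_def)
  qed
  then have "cylinders \<subseteq> sets (multiset_space :: 'a multiset measure)"
    by (auto elim!: cylindersE)
  then show "sigma_sets UNIV cylinders \<subseteq> sets (multiset_space :: 'a multiset measure)"
    using sets.sigma_sets_subset[of cylinders multiset_space] by simp
qed

lemma sets_pair_cylinders:
  "sets (borel \<Otimes>\<^sub>M multiset_space :: ('a::topological_space \<times> _) measure) =
     sigma_sets UNIV {A \<times> C | A C. A \<in> sets borel \<and> C \<in> cylinders}"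
proof -
  have "sets (borel \<Otimes>\<^sub>M multiset_space :: ('a \<times> _) measure) =
      sets (sigma (space borel \<times> space multiset_space) {A \<times> C | A C. A \<in> sets (borel :: 'a measure) \<and> C \<in> cylinders})"
    by (rule sets_pair_eq[where Ca = "{UNIV}" and Cb = "{UNIV}"])
       (simp_all add: sets_multiset_space_cylinders UNIV_in_cylinders sets.sigma_sets_eq[of borel, simplified])
  then show ?thesis by simp
qed

locale poisson_mset = prob_space P for P :: "'w measure" +
  fixes Z :: "'w \<Rightarrow> 'a::{second_countable_topology, t1_space} multiset" and \<Lambda> :: "'a measure"
  assumes Z [measurable]: "Z \<in> measurable P multiset_space"
    and sets_\<Lambda> [measurable_cong, simp]: "sets \<Lambda> = sets borel"
    and finite_\<Lambda>: "finite_measure \<Lambda>"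
    and poisson_counts: "\<And>B k. B \<in> sets borel \<Longrightarrow>
      prob {w \<in> space P. counts B (Z w) = k} = measure \<Lambda> B ^ k / fact k * exp (- measure \<Lambda> B)"
    and indep_counts: "\<And>B (n::nat). (\<And>i. i < n \<Longrightarrow> B i \<in> sets borel) \<Longrightarrow> disjoint_family_on B {..<n} \<Longrightarrow>
      indep_vars (\<lambda>_. count_space UNIV) (\<lambda>i w. counts (B i) (Z w)) {..<n}"
begin

interpretation \<Lambda>: finite_measure \<Lambda> by (rule finite_\<Lambda>)

text \<open>
  The sets \<open>B i\<close> and \<open>A\<close> cut the space into finitely many atoms.  On the atoms the counts are independent
  Poisson variables, and the counts of \<open>B i\<close> are sums of them.  Removing a point of an atom \<open>j\<close> lowers the
  count of \<open>j\<close> by one, so the sum over the points of atom \<open>j\<close> is the expectation computed by the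
  shift of a Poisson vector in coordinate \<open>j\<close>; the atoms contained in \<open>A\<close> contribute a total mass of \<open>\<Lambda> A\<close>.
\<close>

lemma mecke_cylinder:
  fixes n :: nat
  assumes A [measurable]: "A \<in> sets borel" and B: "\<And>i. i < n \<Longrightarrow> B i \<in> sets borel"
  shows "(\<integral>\<^sup>+w. (\<Sum>x\<in>#Z w. of_bool (x \<in> A \<and> (\<forall>i<n. counts (B i) (Z w - {#x#}) = k i))) \<partial>P) =
    emeasure \<Lambda> A * emeasure P {w \<in> space P. \<forall>i<n. counts (B i) (Z w) = k i}"
proof -
  define B' where "B' i = (if i < n then B i else A)" for i
  have [measurable]: "B' i \<in> sets borel" for i using B by (auto simp: B'_def)
  obtain e where e: "bij_betw e {..<card (Pow {..n})} (Pow {..n})"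
    using ex_bij_betw_nat_finite[of "Pow {..n}"] unfolding atLeast0LessThan by auto
  define m where "m = card (Pow {..n})"
  note e = e[folded m_def]
  \<comment> \<open>An atom is determined by the set of those \<open>B' i\<close> that contain it, where \<open>B' n = A\<close>;
    \<open>e\<close> numbers the subsets of \<open>{..n}\<close> and \<open>idx x\<close> is the number of the atom of \<open>x\<close>.\<close>
  define idx where "idx x = inv_into {..<m} e {i. i \<le> n \<and> x \<in> B' i}" for x
  have idx: "idx x < m" "e (idx x) = {i. i \<le> n \<and> x \<in> B' i}" for x
  proof -
    have *: "{i. i \<le> n \<and> x \<in> B' i} \<in> e ` {..<m}" using e by (auto simp: bij_betw_def)
    show "idx x < m" "e (idx x) = {i. i \<le> n \<and> x \<in> B' i}"
      using inv_into_into[OF *] f_inv_into_f[OF *] by (auto simp: idx_def)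
  qed
  have idx_eq: "idx x = j \<longleftrightarrow> {i. i \<le> n \<and> x \<in> B' i} = e j" if "j < m" for x j
    using idx[of x] e that by (auto simp: bij_betw_def inj_on_def)
  define c where "c j = {x. idx x = j}" for j
  have c [measurable]: "c j \<in> sets borel" for j
  proof (cases "j < m")
    case True
    then have "e j \<subseteq> {..n}" using e by (auto simp: bij_betw_def)
    then have "c j = {x \<in> space borel. \<forall>i\<in>{..n}. x \<in> B' i \<longleftrightarrow> i \<in> e j}"
      by (auto simp: c_def idx_eq[OF True])
    also have "\<dots> \<in> sets borel" by measurable
    finally show ?thesis .
  next
    case False
    then have "c j = {}" using idx(1) by (auto simp: c_def)
    then show ?thesis by simp
  qed
  have counts_B': "counts (B' i) M = (\<Sum>j<m. of_bool (i \<in> e j) * counts (c j) M)" if "i \<le> n" for i M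
  proof (induction M)
    case (add x M)
    have "(\<Sum>j<m. of_bool (i \<in> e j) * of_bool (x \<in> c j)) = (\<Sum>j<m. if j = idx x then of_bool (x \<in> B' i) else 0 :: nat)"
      using that by (intro sum.cong) (auto simp: c_def idx)
    also have "\<dots> = of_bool (x \<in> B' i)" using idx(1) by simp
    finally show ?case by (simp add: add distrib_left sum.distrib)
  qed simp
  have sum_idx: "(\<Sum>x\<in>#M. H (idx x)) = (\<Sum>j<m. of_nat (counts (c j) M) * H j)" for M and H :: "nat \<Rightarrow> ennreal"
  proof (induction M)
    case (add x M)
    have "(\<Sum>j<m. of_bool (x \<in> c j) * H j) = (\<Sum>j<m. if j = idx x then H (idx x) else 0)"
      by (intro sum.cong) (auto simp: c_def)
    also have "\<dots> = H (idx x)" using idx(1) by simp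
    finally show ?case by (simp add: add distrib_right sum.distrib)
  qed simp
  define \<Phi> :: "(nat \<Rightarrow> nat) \<Rightarrow> ennreal" where
    "\<Phi> v = of_bool (\<forall>i<n. (\<Sum>j<m. of_bool (i \<in> e j) * v j) = k i)" for v
  define N where "N j w = counts (c j) (Z w)" for j w
  have [measurable]: "N j \<in> measurable P (count_space UNIV)" for j unfolding N_def by measurable
  have \<Phi>_counts: "of_bool (\<forall>i<n. counts (B i) M = k i) = \<Phi> (\<lambda>j\<in>{..<m}. counts (c j) M)" for M
  proof -
    have "counts (B i) M = (\<Sum>j<m. of_bool (i \<in> e j) * (\<lambda>j\<in>{..<m}. counts (c j) M) j)" if "i < n" for i
      using counts_B'[of i M] that by (simp add: B'_def)
    then show ?thesis by (simp add: \<Phi>_def)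
  qed
  have remove: "of_bool (x \<in> A \<and> (\<forall>i<n. counts (B i) (Z w - {#x#}) = k i)) =
      (\<lambda>j. of_bool (n \<in> e j) * \<Phi> ((\<lambda>j\<in>{..<m}. N j w)(j := N j w - 1))) (idx x)"
    if "x \<in># Z w" for x w
  proof -
    have "(\<lambda>j\<in>{..<m}. counts (c j) (Z w - {#x#})) = (\<lambda>j\<in>{..<m}. N j w)(idx x := N (idx x) w - 1)"
      using that idx(1) by (auto simp: fun_eq_iff counts_remove N_def c_def restrict_def)
    moreover have "x \<in> A \<longleftrightarrow> n \<in> e (idx x)" by (simp add: idx B'_def)
    ultimately show ?thesis using \<Phi>_counts[of "Z w - {#x#}"] by (simp add: of_bool_conj)
  qed
  have indep: "indep_vars (\<lambda>_. count_space UNIV) N {..<m}"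
    unfolding N_def[abs_def] by (rule indep_counts) (rule c, auto simp: c_def disjoint_family_on_def)
  have \<Phi>_measurable: "(\<lambda>w. \<Phi> ((\<lambda>j\<in>{..<m}. N j w)(l := N l w - 1))) \<in> borel_measurable P" if "l < m" for l
  proof -
    have "(\<Sum>j<m. of_bool (i \<in> e j) * ((\<lambda>j\<in>{..<m}. N j w)(l := N l w - 1)) j) =
        (\<Sum>j<m. of_bool (i \<in> e j) * (if j = l then N l w - 1 else N j w))" for i w
      by (intro sum.cong) auto
    then have "\<Phi> ((\<lambda>j\<in>{..<m}. N j w)(l := N l w - 1)) =
        of_bool (\<forall>i\<in>{..<n}. (\<Sum>j<m. of_bool (i \<in> e j) * (if j = l then N l w - 1 else N j w)) = k i)" for w
      by (simp add: \<Phi>_def Ball_def)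
    moreover have "(\<lambda>w. of_bool (\<forall>i\<in>{..<n}. (\<Sum>j<m. of_bool (i \<in> e j) * (if j = l then N l w - 1 else N j w)) = k i) :: ennreal)
        \<in> borel_measurable P"
      unfolding of_bool_def by measurable
    ultimately show ?thesis by simp
  qed
  have "(\<integral>\<^sup>+w. (\<Sum>x\<in>#Z w. of_bool (x \<in> A \<and> (\<forall>i<n. counts (B i) (Z w - {#x#}) = k i))) \<partial>P) =
      (\<integral>\<^sup>+w. (\<Sum>j<m. of_bool (n \<in> e j) * (of_nat (N j w) * \<Phi> ((\<lambda>j\<in>{..<m}. N j w)(j := N j w - 1)))) \<partial>P)"
  proof (rule nn_integral_cong)
    fix w
    have "(\<Sum>x\<in>#Z w. of_bool (x \<in> A \<and> (\<forall>i<n. counts (B i) (Z w - {#x#}) = k i))) =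
        (\<Sum>x\<in>#Z w. (\<lambda>j. of_bool (n \<in> e j) * \<Phi> ((\<lambda>j\<in>{..<m}. N j w)(j := N j w - 1))) (idx x))"
      by (intro arg_cong[where f = sum_mset] image_mset_cong remove)
    also have "\<dots> = (\<Sum>j<m. of_nat (counts (c j) (Z w)) *
        (of_bool (n \<in> e j) * \<Phi> ((\<lambda>j\<in>{..<m}. N j w)(j := N j w - 1))))"
      by (rule sum_idx)
    also have "\<dots> = (\<Sum>j<m. of_bool (n \<in> e j) * (of_nat (N j w) * \<Phi> ((\<lambda>j\<in>{..<m}. N j w)(j := N j w - 1))))"
      by (intro sum.cong refl) (simp only: N_def mult.left_commute)
    finally show "(\<Sum>x\<in>#Z w. of_bool (x \<in> A \<and> (\<forall>i<n. counts (B i) (Z w - {#x#}) = k i))) =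
        (\<Sum>j<m. of_bool (n \<in> e j) * (of_nat (N j w) * \<Phi> ((\<lambda>j\<in>{..<m}. N j w)(j := N j w - 1))))" .
  qed
  also have "\<dots> = (\<Sum>j<m. of_bool (n \<in> e j) *
      (\<integral>\<^sup>+w. of_nat (N j w) * \<Phi> ((\<lambda>j\<in>{..<m}. N j w)(j := N j w - 1)) \<partial>P))"
  proof (subst nn_integral_sum)
    have meas: "(\<lambda>w. of_nat (N j w) * \<Phi> ((\<lambda>j\<in>{..<m}. N j w)(j := N j w - 1))) \<in> borel_measurable P"
      if "j < m" for j
      by (intro borel_measurable_times_ennreal \<Phi>_measurable that) measurable
    show "(\<lambda>w. of_bool (n \<in> e j) * (of_nat (N j w) * \<Phi> ((\<lambda>j\<in>{..<m}. N j w)(j := N j w - 1))))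
        \<in> borel_measurable P" if "j \<in> {..<m}" for j
      using that by (intro borel_measurable_times_ennreal[OF borel_measurable_const] meas) simp
    show "(\<Sum>j<m. \<integral>\<^sup>+w. of_bool (n \<in> e j) * (of_nat (N j w) * \<Phi> ((\<lambda>j\<in>{..<m}. N j w)(j := N j w - 1))) \<partial>P) =
        (\<Sum>j<m. of_bool (n \<in> e j) * (\<integral>\<^sup>+w. of_nat (N j w) * \<Phi> ((\<lambda>j\<in>{..<m}. N j w)(j := N j w - 1)) \<partial>P))"
      by (intro sum.cong refl nn_integral_cmult meas) simp
  qed
  also have "\<dots> = (\<Sum>j<m. of_bool (n \<in> e j) * (emeasure \<Lambda> (c j) * (\<integral>\<^sup>+w. \<Phi> (\<lambda>j\<in>{..<m}. N j w) \<partial>P)))"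
  proof (intro sum.cong refl arg_cong2[where f = "(*)"])
    fix j assume "j \<in> {..<m}"
    then show "(\<integral>\<^sup>+w. of_nat (N j w) * \<Phi> ((\<lambda>j\<in>{..<m}. N j w)(j := N j w - 1)) \<partial>P) =
        emeasure \<Lambda> (c j) * (\<integral>\<^sup>+w. \<Phi> (\<lambda>j\<in>{..<m}. N j w) \<partial>P)"
      unfolding \<Lambda>.emeasure_eq_measure
      by (intro nn_integral_indep_poisson_shift indep) (auto simp: N_def poisson_counts)
  qed
  also have "\<dots> = (\<Sum>j<m. of_bool (n \<in> e j) * emeasure \<Lambda> (c j)) * (\<integral>\<^sup>+w. \<Phi> (\<lambda>j\<in>{..<m}. N j w) \<partial>P)"
    by (simp add: sum_distrib_right mult.assoc)
  also have "(\<Sum>j<m. of_bool (n \<in> e j) * emeasure \<Lambda> (c j)) = emeasure \<Lambda> A"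
  proof -
    have "(\<Sum>j<m. of_bool (n \<in> e j) * emeasure \<Lambda> (c j)) = (\<Sum>j | j < m \<and> n \<in> e j. emeasure \<Lambda> (c j))"
      by (intro sum.mono_neutral_cong_right) auto
    also have "\<dots> = emeasure \<Lambda> (\<Union>j\<in>{j. j < m \<and> n \<in> e j}. c j)"
    proof (rule sum_emeasure)
      show "c ` {j. j < m \<and> n \<in> e j} \<subseteq> sets \<Lambda>" using c by auto
      show "disjoint_family_on c {j. j < m \<and> n \<in> e j}" by (auto simp: disjoint_family_on_def c_def)
    qed simp
    also have "(\<Union>j\<in>{j. j < m \<and> n \<in> e j}. c j) = A"
      using idx by (auto simp: c_def B'_def)
    finally show ?thesis .
  qed
  also have "(\<integral>\<^sup>+w. \<Phi> (\<lambda>j\<in>{..<m}. N j w) \<partial>P) = emeasure P {w \<in> space P. \<forall>i<n. counts (B i) (Z w) = k i}"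
  proof -
    have [measurable]: "Measurable.pred P (\<lambda>w. counts (B i) (Z w) = k i)" if "i < n" for i
    proof -
      have [measurable]: "B i \<in> sets borel" using B that by simp
      show ?thesis by measurable
    qed
    have "{w \<in> space P. \<forall>i\<in>{..<n}. counts (B i) (Z w) = k i} \<in> sets P" by measurable
    then have S: "{w \<in> space P. \<forall>i<n. counts (B i) (Z w) = k i} \<in> sets P" by (simp add: Ball_def)
    have "(\<integral>\<^sup>+w. \<Phi> (\<lambda>j\<in>{..<m}. N j w) \<partial>P) =
        (\<integral>\<^sup>+w. indicator {w \<in> space P. \<forall>i<n. counts (B i) (Z w) = k i} w \<partial>P)"
      by (intro nn_integral_cong) (auto simp: \<Phi>_counts[of "Z _", folded N_def, symmetric] indicator_def)
    then show ?thesis using S by simp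
  qed
  finally show ?thesis .
qed

text \<open>
  Both sides integrate the function against a measure on pairs of a point and a multiset.  These finite measures agree
  on products with cylinders, hence everywhere.
\<close>

lemma mecke:
  fixes F :: "'a \<times> 'a multiset \<Rightarrow> ennreal"
  assumes F: "F \<in> borel_measurable (borel \<Otimes>\<^sub>M multiset_space)"
  shows "(\<integral>\<^sup>+w. (\<Sum>x\<in>#Z w. F (x, Z w - {#x#})) \<partial>P) = (\<integral>\<^sup>+x. \<integral>\<^sup>+w. F (x, Z w) \<partial>P \<partial>\<Lambda>)"
proof -
  interpret \<Lambda>P: pair_sigma_finite \<Lambda> P ..
  have int_Z: "(\<integral>\<^sup>+x. F (x, Z w - {#x#}) \<partial>mset_measure (Z w)) = (\<Sum>x\<in>#Z w. F (x, Z w - {#x#}))"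
    if [measurable]: "F \<in> borel_measurable (borel \<Otimes>\<^sub>M multiset_space)" for F w
    by (rule nn_integral_mset_measure) measurable
  obtain \<kappa> where sets_\<kappa>: "sets \<kappa> = sets (borel \<Otimes>\<^sub>M (multiset_space :: 'a multiset measure))"
    and \<kappa>: "\<And>F. F \<in> borel_measurable (borel \<Otimes>\<^sub>M multiset_space) \<Longrightarrow>
      (\<integral>\<^sup>+z. F z \<partial>\<kappa>) = (\<integral>\<^sup>+w. \<integral>\<^sup>+x. F (x, Z w - {#x#}) \<partial>mset_measure (Z w) \<partial>P)"
  proof (rule ex_mixture_measure)
    show "(\<lambda>x. (x, Z w - {#x#})) \<in> measurable (mset_measure (Z w)) (borel \<Otimes>\<^sub>M multiset_space)" for w
      by measurable
    fix F :: "'a \<times> 'a multiset \<Rightarrow> ennreal"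
    assume F [measurable]: "F \<in> borel_measurable (borel \<Otimes>\<^sub>M multiset_space)"
    show "(\<lambda>w. \<integral>\<^sup>+x. F (x, Z w - {#x#}) \<partial>mset_measure (Z w)) \<in> borel_measurable P"
      unfolding int_Z[OF F] by measurable
  qed (rule that)
  define \<rho> where "\<rho> = distr (\<Lambda> \<Otimes>\<^sub>M P) (borel \<Otimes>\<^sub>M multiset_space) (\<lambda>(x, w). (x, Z w))"
  have \<rho>: "(\<integral>\<^sup>+z. F z \<partial>\<rho>) = (\<integral>\<^sup>+x. \<integral>\<^sup>+w. F (x, Z w) \<partial>P \<partial>\<Lambda>)"
    if [measurable]: "F \<in> borel_measurable (borel \<Otimes>\<^sub>M multiset_space)" for F
  proof -
    have "(\<integral>\<^sup>+z. F z \<partial>\<rho>) = (\<integral>\<^sup>+z. F (fst z, Z (snd z)) \<partial>(\<Lambda> \<Otimes>\<^sub>M P))"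
      unfolding \<rho>_def by (subst nn_integral_distr) (auto simp: case_prod_beta')
    also have "\<dots> = (\<integral>\<^sup>+x. \<integral>\<^sup>+w. F (x, Z w) \<partial>P \<partial>\<Lambda>)"
      by (subst nn_integral_fst[symmetric]) simp_all
    finally show ?thesis .
  qed
  have "\<kappa> = \<rho>"
  proof (rule measure_eqI_generator_eq)
    let ?E = "{A \<times> C | A C. A \<in> sets (borel :: 'a measure) \<and> C \<in> cylinders}"
    show "Int_stable ?E"
      unfolding Int_stable_def by (auto simp: Times_Int_Times) (use cylinders_Int in blast)
    have eq: "emeasure \<kappa> (A \<times> {M. \<forall>i<n. counts (B i) M = k i}) = emeasure \<Lambda> A * emeasure P {w \<in> space P. \<forall>i<n. counts (B i) (Z w) = k i}"
        "emeasure \<rho> (A \<times> {M. \<forall>i<n. counts (B i) M = k i}) = emeasure \<Lambda> A * emeasure P {w \<in> space P. \<forall>i<n. counts (B i) (Z w) = k i}"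
      if A [measurable]: "A \<in> sets borel" and B: "\<And>i. i < n \<Longrightarrow> B i \<in> sets borel" for A :: "'a set" and B and n :: nat and k
    proof -
      let ?C = "{M. \<forall>i<n. counts (B i) M = k i}"
      have C [measurable]: "?C \<in> sets multiset_space"
        using cylindersI[of n B k, OF B] by (auto simp: sets_multiset_space_cylinders)
      have "emeasure \<kappa> (A \<times> ?C) = (\<integral>\<^sup>+z. indicator (A \<times> ?C) z \<partial>\<kappa>)"
        by (subst nn_integral_indicator) (auto simp: sets_\<kappa>)
      also have "\<dots> = (\<integral>\<^sup>+w. (\<Sum>x\<in>#Z w. of_bool (x \<in> A \<and> (\<forall>i<n. counts (B i) (Z w - {#x#}) = k i))) \<partial>P)"
        by (subst \<kappa>, simp, subst int_Z)
           (auto simp: indicator_def of_bool_def intro!: nn_integral_cong arg_cong[where f = sum_mset] image_mset_cong)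
      finally show "emeasure \<kappa> (A \<times> ?C) = emeasure \<Lambda> A * emeasure P {w \<in> space P. \<forall>i<n. counts (B i) (Z w) = k i}"
        using mecke_cylinder[OF A B] by simp
      have "(\<lambda>(x, w). (x, Z w)) -` (A \<times> ?C) \<inter> space (\<Lambda> \<Otimes>\<^sub>M P) = A \<times> (Z -` ?C \<inter> space P)"
        by (auto simp: space_pair_measure sets_eq_imp_space_eq[OF sets_\<Lambda>])
      then have "emeasure \<rho> (A \<times> ?C) = emeasure (\<Lambda> \<Otimes>\<^sub>M P) (A \<times> (Z -` ?C \<inter> space P))"
        unfolding \<rho>_def by (subst emeasure_distr) simp_all
      also have "\<dots> = emeasure \<Lambda> A * emeasure P (Z -` ?C \<inter> space P)"
        by (rule emeasure_pair_measure_Times[OF _ measurable_sets[OF Z C]]) (simp add: A)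
      also have "Z -` ?C \<inter> space P = {w \<in> space P. \<forall>i<n. counts (B i) (Z w) = k i}" by auto
      finally show "emeasure \<rho> (A \<times> ?C) = emeasure \<Lambda> A * emeasure P {w \<in> space P. \<forall>i<n. counts (B i) (Z w) = k i}" .
    qed
    show "emeasure \<kappa> X = emeasure \<rho> X" if X: "X \<in> ?E" for X
    proof -
      from X obtain A C where X: "X = A \<times> C" "A \<in> sets borel" "C \<in> cylinders" by auto
      from X(3) show ?thesis
        by (rule cylindersE) (simp only: X(1) eq[OF X(2)])
    qed
    show "sets \<kappa> = sigma_sets UNIV ?E" "sets \<rho> = sigma_sets UNIV ?E"
      by (simp_all add: sets_\<kappa> \<rho>_def sets_pair_cylinders)
    show "range (\<lambda>_::nat. UNIV) \<subseteq> ?E"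
      using UNIV_in_cylinders by (auto intro!: exI[of _ UNIV])
    show "emeasure \<kappa> UNIV \<noteq> \<infinity>"
      using eq(1)[of UNIV 0] \<Lambda>.emeasure_finite[of UNIV] by (simp add: emeasure_space_1)
  qed auto
  then show ?thesis using \<kappa>[OF F] \<rho>[OF F] int_Z[OF F] by simp
qed

end

section \<open>Expectations over a random multiset\<close>

text \<open>
  Differentiation under the integral sign: a common bound of the derivatives bounds the difference
  quotients by the mean value theorem, and dominated convergence applies.  The one-sided derivatives
  at the ends of the interval are included.
\<close>

lemma has_real_derivative_integral:
  fixes f f' :: "real \<Rightarrow> 'w \<Rightarrow> real"
  assumes S: "convex S" "t \<in> S"
    and f: "\<And>s. s \<in> S \<Longrightarrow> integrable P (f s)"
    and f': "f' t \<in> borel_measurable P"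
    and D: "\<And>s w. s \<in> S \<Longrightarrow> w \<in> space P \<Longrightarrow> ((\<lambda>s. f s w) has_real_derivative f' s w) (at s within S)"
    and B: "integrable P B" "\<And>s w. s \<in> S \<Longrightarrow> w \<in> space P \<Longrightarrow> \<bar>f' s w\<bar> \<le> B w"
  shows "((\<lambda>s. \<integral>w. f s w \<partial>P) has_real_derivative (\<integral>w. f' t w \<partial>P)) (at t within S)"
  unfolding has_field_derivative_iff tendsto_at_iff_sequentially
proof (intro allI impI)
  fix s :: "nat \<Rightarrow> real" assume s: "\<forall>i. s i \<in> S - {t}" "s \<longlonglongrightarrow> t"
  let ?q = "\<lambda>i w. (f (s i) w - f t w) / (s i - t)"
  have "(\<lambda>i. \<integral>w. ?q i w \<partial>P) \<longlonglongrightarrow> (\<integral>w. f' t w \<partial>P)"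
  proof (rule integral_dominated_convergence[where w = B])
    show "?q i \<in> borel_measurable P" for i
      using f[THEN borel_measurable_integrable] s S by auto
    show "AE w in P. (\<lambda>i. ?q i w) \<longlonglongrightarrow> f' t w"
    proof (rule AE_I2)
      fix w assume "w \<in> space P"
      from D[OF S(2) this] s show "(\<lambda>i. ?q i w) \<longlonglongrightarrow> f' t w"
        unfolding has_field_derivative_iff tendsto_at_iff_sequentially by (auto simp: o_def)
    qed
    show "AE w in P. norm (?q i w) \<le> B w" for i
    proof (rule AE_I2)
      fix w assume w: "w \<in> space P"
      have "norm (f (s i) w - f t w) \<le> B w * norm (s i - t)"
        using s S by (intro field_differentiable_bound[OF S(1), where f' = "\<lambda>s. f' s w"] D w) (auto intro!: B w)
      moreover have "\<bar>s i - t\<bar> > 0" using s by auto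
      ultimately show "norm (?q i w) \<le> B w" by (simp add: divide_simps)
    qed
  qed (use f' B in auto)
  then show "((\<lambda>y. ((\<integral>w. f y w \<partial>P) - (\<integral>w. f t w \<partial>P)) / (y - t)) \<circ> s) \<longlonglongrightarrow> (\<integral>w. f' t w \<partial>P)"
    using f s S by (simp add: o_def)
qed

lemma abs_sum_mset_le:
  assumes "\<And>x. x \<in># M \<Longrightarrow> \<bar>f x\<bar> \<le> (1::real)"
  shows "\<bar>\<Sum>x\<in>#M. f x\<bar> \<le> size M"
  using assms
proof (induction M)
  case (add x M)
  have "\<bar>\<Sum>x\<in>#M. f x\<bar> \<le> size M" "\<bar>f x\<bar> \<le> 1" using add by simp_all
  then show ?case by simp
qed simp

lemma thin_integral:
  assumes "\<And>K. integrable \<Lambda> (\<lambda>x. F x K)"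
  shows "integrable \<Lambda> (\<lambda>x. thin t M (F x))"
    and "thin t M (\<lambda>K. \<integral>x. F x K \<partial>\<Lambda>) = (\<integral>x. thin t M (F x) \<partial>\<Lambda>)"
proof -
  have "integrable \<Lambda> (\<lambda>x. thin t M (F x)) \<and> thin t M (\<lambda>K. \<integral>x. F x K \<partial>\<Lambda>) = (\<integral>x. thin t M (F x) \<partial>\<Lambda>)"
    using assms
  proof (induction M arbitrary: F)
    case (add y M)
    from add.IH[of "\<lambda>x K. F x (add_mset y K)"] add.IH[of F] add.prems show ?case by simp
  qed simp
  then show "integrable \<Lambda> (\<lambda>x. thin t M (F x))"
    and "thin t M (\<lambda>K. \<integral>x. F x K \<partial>\<Lambda>) = (\<integral>x. thin t M (F x) \<partial>\<Lambda>)" by auto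
qed

text \<open>
  Counting measures that differ by one additional point, or by the position of one point, have
  total variation distance at most one.  The second condition is not implied by the first, which
  gives only the bound two; it is responsible for the constant one in front of the total variation
  distance of the intensity measures.
\<close>

definition mset_Lipschitz :: "('a multiset \<Rightarrow> real) \<Rightarrow> bool" where
  "mset_Lipschitz h \<longleftrightarrow> (\<forall>x M. \<bar>h (add_mset x M) - h M\<bar> \<le> 1) \<and>
     (\<forall>x y M. \<bar>h (add_mset x M) - h (add_mset y M)\<bar> \<le> 1)"

lemma mset_Lipschitz_growth:
  assumes "mset_Lipschitz h"
  shows "\<bar>h (K + M)\<bar> \<le> \<bar>h {#}\<bar> + size K + size M"
proof -
  have "\<bar>h N\<bar> \<le> \<bar>h {#}\<bar> + size N" for N
  proof (induction N)
    case (add x N)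
    moreover have "\<bar>h (add_mset x N) - h N\<bar> \<le> 1" using assms by (simp add: mset_Lipschitz_def)
    ultimately show ?case by simp
  qed simp
  from this[of "K + M"] show ?thesis by simp
qed

lemma borel_measurable_thin' [measurable (raw)]:
  fixes G :: "'p \<Rightarrow> 'a::{second_countable_topology, t1_space} multiset \<Rightarrow> real"
  assumes G: "(\<lambda>(p, K). G p K) \<in> borel_measurable (N \<Otimes>\<^sub>M multiset_space)"
    and [measurable]: "f \<in> measurable N multiset_space"
  shows "(\<lambda>p. thin t (f p) (G p)) \<in> borel_measurable N"
proof -
  have "(\<lambda>p. (p, f p)) \<in> measurable N (N \<Otimes>\<^sub>M multiset_space)" by measurable
  from measurable_compose[OF this borel_measurable_thin[OF G, of t]] show ?thesis by simp
qed

locale random_mset = prob_space P for P :: "'w measure" +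
  fixes Z :: "'w \<Rightarrow> 'a::{second_countable_topology, t1_space} multiset"
  assumes Z [measurable]: "Z \<in> measurable P multiset_space"
    and integrable_size: "integrable P (\<lambda>w. real (size (Z w)))"
begin

lemma integrable_thin:
  fixes c :: real
  assumes t: "t \<in> {0..1}" and [measurable]: "g \<in> borel_measurable multiset_space"
    and g: "\<And>K. \<bar>g K\<bar> \<le> c + real (size K)"
  shows "integrable P (\<lambda>w. thin t (Z w) g)"
proof (rule Bochner_Integration.integrable_bound)
  show "integrable P (\<lambda>w. c + real (size (Z w)))" using integrable_size by simp
  have "\<bar>thin t (Z w) g\<bar> \<le> c + real (size (Z w))" for w
  proof (rule abs_thin_le[OF t])
    fix K assume "K \<subseteq># Z w"
    then have "size K \<le> size (Z w)" by (rule size_mset_mono)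
    with g[of K] show "\<bar>g K\<bar> \<le> c + real (size (Z w))" by simp
  qed
  then show "AE w in P. norm (thin t (Z w) g) \<le> norm (c + real (size (Z w)))"
    by (intro AE_I2) (auto intro: order_trans[OF _ abs_ge_self])
qed measurable

text \<open>
  Palm and Mecke formulas are equations for nonnegative functions.  A function \<open>v\<close> with values in
  \<open>[-1, 1]\<close> is moved into their range by adding one; this lemma and the following one express the
  two sides of such an equation for \<open>1 + v\<close> through real integrals of \<open>v\<close>.
\<close>

lemma
  fixes v :: "'a \<Rightarrow> 'a multiset \<Rightarrow> real"
  assumes [measurable]: "(\<lambda>(x, M). v x M) \<in> borel_measurable (borel \<Otimes>\<^sub>M multiset_space)"
    and v: "\<And>x M. \<bar>v x M\<bar> \<le> 1"
  shows integrable_sum_remove: "integrable P (\<lambda>w. \<Sum>x\<in>#Z w. v x (Z w - {#x#}))"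
    and nn_integral_sum_remove:
      "(\<integral>\<^sup>+w. (\<Sum>x\<in>#Z w. ennreal (1 + v x (Z w - {#x#}))) \<partial>P) =
        ennreal ((\<integral>w. size (Z w) \<partial>P) + (\<integral>w. (\<Sum>x\<in>#Z w. v x (Z w - {#x#})) \<partial>P))"
proof -
  let ?S = "\<lambda>w. \<Sum>x\<in>#Z w. v x (Z w - {#x#})"
  have [measurable]: "?S \<in> borel_measurable P" by measurable
  have bound: "\<bar>?S w\<bar> \<le> size (Z w)" for w by (rule abs_sum_mset_le) (rule v)
  show int: "integrable P ?S"
    by (rule Bochner_Integration.integrable_bound[OF integrable_size]) (auto simp: bound)
  have "(\<Sum>x\<in>#M. ennreal (1 + v x (N - {#x#}))) = ennreal (size M + (\<Sum>x\<in>#M. v x (N - {#x#})))" for M N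
  proof -
    have "0 \<le> 1 + v x (N - {#x#})" for x using v[of x "N - {#x#}"] by simp
    then have "(\<Sum>x\<in>#M. ennreal (1 + v x (N - {#x#}))) = ennreal (\<Sum>x\<in>#M. 1 + v x (N - {#x#}))"
      unfolding ennreal_sum_mset by (simp add: max_def)
    then show ?thesis by (simp add: sum_mset.distrib)
  qed
  then have "(\<integral>\<^sup>+w. (\<Sum>x\<in>#Z w. ennreal (1 + v x (Z w - {#x#}))) \<partial>P) = (\<integral>\<^sup>+w. ennreal (size (Z w) + ?S w) \<partial>P)"
    by simp
  also have "\<dots> = ennreal (\<integral>w. size (Z w) + ?S w \<partial>P)"
  proof (rule nn_integral_eq_integral)
    show "AE w in P. 0 \<le> real (size (Z w)) + ?S w"
      using bound by (intro AE_I2) (smt (verit))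
  qed (use int integrable_size in auto)
  also have "(\<integral>w. size (Z w) + ?S w \<partial>P) = (\<integral>w. size (Z w) \<partial>P) + (\<integral>w. ?S w \<partial>P)"
    by (rule Bochner_Integration.integral_add[OF integrable_size int])
  finally show "(\<integral>\<^sup>+w. (\<Sum>x\<in>#Z w. ennreal (1 + v x (Z w - {#x#}))) \<partial>P) =
        ennreal ((\<integral>w. size (Z w) \<partial>P) + (\<integral>w. ?S w \<partial>P))" .
qed

lemma
  fixes v :: "'a \<Rightarrow> 'a multiset \<Rightarrow> real" and \<Lambda> :: "'a measure"
  assumes v_meas [measurable]: "(\<lambda>(x, M). v x M) \<in> borel_measurable (borel \<Otimes>\<^sub>M multiset_space)"
    and v: "\<And>x M. \<bar>v x M\<bar> \<le> 1"
    and \<Lambda>: "finite_measure \<Lambda>" and sets_\<Lambda> [measurable_cong]: "sets \<Lambda> = sets borel"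
  shows integrable_product: "integrable (\<Lambda> \<Otimes>\<^sub>M P) (\<lambda>(x, w). v x (Z w))"
    and integral_product_swap: "(\<integral>x. (\<integral>w. v x (Z w) \<partial>P) \<partial>\<Lambda>) = (\<integral>w. (\<integral>x. v x (Z w) \<partial>\<Lambda>) \<partial>P)"
    and nn_integral_product:
      "(\<integral>\<^sup>+x. (\<integral>\<^sup>+w. ennreal (1 + v x (Z w)) \<partial>P) \<partial>\<Lambda>) =
        ennreal (measure \<Lambda> (space \<Lambda>) + (\<integral>w. (\<integral>x. v x (Z w) \<partial>\<Lambda>) \<partial>P))"
proof -
  interpret \<Lambda>: finite_measure \<Lambda> by fact
  interpret \<Lambda>P: pair_sigma_finite \<Lambda> P ..
  have fin: "emeasure (\<Lambda> \<Otimes>\<^sub>M P) (space (\<Lambda> \<Otimes>\<^sub>M P)) = emeasure \<Lambda> (space \<Lambda>)"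
    by (simp add: space_pair_measure emeasure_pair_measure_Times emeasure_space_1)
  interpret prod: finite_measure "\<Lambda> \<Otimes>\<^sub>M P"
    by (rule finite_measureI) (simp add: fin)
  have [measurable]: "(\<lambda>z. v (fst z) (Z (snd z))) \<in> borel_measurable (\<Lambda> \<Otimes>\<^sub>M P)" by measurable
  show int: "integrable (\<Lambda> \<Otimes>\<^sub>M P) (\<lambda>(x, w). v x (Z w))"
    by (rule prod.integrable_const_bound[where B = 1]) (auto simp: v case_prod_beta')
  show swap: "(\<integral>x. (\<integral>w. v x (Z w) \<partial>P) \<partial>\<Lambda>) = (\<integral>w. (\<integral>x. v x (Z w) \<partial>\<Lambda>) \<partial>P)"
    using \<Lambda>P.Fubini_integral[OF int] by simp
  have "(\<integral>\<^sup>+x. (\<integral>\<^sup>+w. ennreal (1 + v x (Z w)) \<partial>P) \<partial>\<Lambda>) =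
      (\<integral>\<^sup>+z. ennreal (1 + v (fst z) (Z (snd z))) \<partial>(\<Lambda> \<Otimes>\<^sub>M P))"
    by (subst nn_integral_fst[symmetric]) simp_all
  also have "\<dots> = ennreal (\<integral>z. 1 + v (fst z) (Z (snd z)) \<partial>(\<Lambda> \<Otimes>\<^sub>M P))"
  proof (rule nn_integral_eq_integral)
    show "AE z in \<Lambda> \<Otimes>\<^sub>M P. 0 \<le> 1 + v (fst z) (Z (snd z))"
      using v by (intro AE_I2) (smt (verit))
  qed (use int in \<open>simp add: case_prod_beta'\<close>)
  also have "(\<integral>z. 1 + v (fst z) (Z (snd z)) \<partial>(\<Lambda> \<Otimes>\<^sub>M P)) =
      measure \<Lambda> (space \<Lambda>) + (\<integral>z. (case z of (x, w) \<Rightarrow> v x (Z w)) \<partial>(\<Lambda> \<Otimes>\<^sub>M P))"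
    using int by (simp add: case_prod_beta' measure_def fin)
  also have "(\<integral>z. (case z of (x, w) \<Rightarrow> v x (Z w)) \<partial>(\<Lambda> \<Otimes>\<^sub>M P)) = (\<integral>x. (\<integral>w. v x (Z w) \<partial>P) \<partial>\<Lambda>)"
    by (rule \<Lambda>P.integral_fst[OF int, symmetric, simplified])
  finally show "(\<integral>\<^sup>+x. (\<integral>\<^sup>+w. ennreal (1 + v x (Z w)) \<partial>P) \<partial>\<Lambda>) =
        ennreal (measure \<Lambda> (space \<Lambda>) + (\<integral>w. (\<integral>x. v x (Z w) \<partial>\<Lambda>) \<partial>P))"
    unfolding swap .
qed

end

section \<open>Interpolation between a random multiset and a Poisson multiset\<close>

context poisson_mset
begin

text \<open>
  The Mecke formula for the constant function one.
\<close>

lemma mean_size: "(\<integral>\<^sup>+w. of_nat (size (Z w)) \<partial>P) = emeasure \<Lambda> UNIV"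
proof -
  have "(\<integral>\<^sup>+w. (\<Sum>x\<in>#Z w. 1) \<partial>P) = (\<integral>\<^sup>+x. \<integral>\<^sup>+w. 1 \<partial>P \<partial>\<Lambda>)"
    by (rule mecke[of "\<lambda>_. 1"]) simp
  then show ?thesis by (simp add: sets_eq_imp_space_eq[OF sets_\<Lambda>] emeasure_space_1)
qed

sublocale random_mset P Z
proof
  show "integrable P (\<lambda>w. real (size (Z w)))"
  proof (rule integrableI_bounded)
    have "(\<integral>\<^sup>+w. ennreal (norm (real (size (Z w)))) \<partial>P) = emeasure \<Lambda> UNIV"
      by (simp add: mean_size ennreal_of_nat_eq_real_of_nat[symmetric])
    then show "(\<integral>\<^sup>+w. ennreal (norm (real (size (Z w)))) \<partial>P) < \<infinity>"
      using finite_measure.emeasure_finite[OF finite_\<Lambda>, of UNIV] by (simp add: less_top)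
  qed measurable
qed (rule Z)

lemma integral_mecke:
  fixes v :: "'a \<Rightarrow> 'a multiset \<Rightarrow> real"
  assumes v_meas: "(\<lambda>(x, M). v x M) \<in> borel_measurable (borel \<Otimes>\<^sub>M multiset_space)"
    and v: "\<And>x M. \<bar>v x M\<bar> \<le> 1"
  shows "(\<integral>w. (\<Sum>x\<in>#Z w. v x (Z w - {#x#})) \<partial>P) = (\<integral>w. (\<integral>x. v x (Z w) \<partial>\<Lambda>) \<partial>P)"
proof -
  note [measurable] = v_meas
  interpret \<Lambda>: finite_measure \<Lambda> by (rule finite_\<Lambda>)
  let ?m = "\<integral>w. size (Z w) \<partial>P" and ?a = "\<integral>w. (\<Sum>x\<in>#Z w. v x (Z w - {#x#})) \<partial>P"
    and ?b = "\<integral>w. (\<integral>x. v x (Z w) \<partial>\<Lambda>) \<partial>P" and ?l = "measure \<Lambda> (space \<Lambda>)"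
  have "ennreal (?m + ?a) = ennreal (?l + ?b)"
    using mecke[of "\<lambda>(x, M). ennreal (1 + v x M)"]
    unfolding nn_integral_sum_remove[OF v_meas v, symmetric]
      nn_integral_product[OF v_meas v finite_\<Lambda> sets_\<Lambda>, symmetric] by simp
  moreover have "?m = ?l"
  proof -
    have "ennreal ?m = emeasure \<Lambda> UNIV"
      unfolding mean_size[symmetric] ennreal_of_nat_eq_real_of_nat
      by (rule nn_integral_eq_integral[symmetric]) (auto simp: integrable_size)
    then show ?thesis
      by (simp add: \<Lambda>.emeasure_eq_measure sets_eq_imp_space_eq[OF sets_\<Lambda>])
  qed
  moreover have "\<bar>?a\<bar> \<le> ?m"
  proof -
    have "\<bar>?a\<bar> \<le> (\<integral>w. \<bar>\<Sum>x\<in>#Z w. v x (Z w - {#x#})\<bar> \<partial>P)" by (rule integral_abs_bound)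
    also have "\<dots> \<le> ?m"
      using integrable_sum_remove[OF v_meas v] integrable_size
      by (intro integral_mono) (auto intro!: abs_sum_mset_le v)
    finally show ?thesis .
  qed
  moreover have "\<bar>?b\<bar> \<le> ?l"
  proof -
    have "\<bar>\<integral>x. v x (Z w) \<partial>\<Lambda>\<bar> \<le> ?l" for w
    proof -
      have "integrable \<Lambda> (\<lambda>x. v x (Z w))"
        by (rule \<Lambda>.integrable_const_bound[where B = 1]) (auto simp: v)
      have "\<bar>\<integral>x. v x (Z w) \<partial>\<Lambda>\<bar> \<le> (\<integral>x. \<bar>v x (Z w)\<bar> \<partial>\<Lambda>)" by (rule integral_abs_bound)
      also have "\<dots> \<le> (\<integral>x. 1 \<partial>\<Lambda>)"
        using \<open>integrable \<Lambda> (\<lambda>x. v x (Z w))\<close> by (intro integral_mono) (auto simp: v)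
      finally show ?thesis by simp
    qed
    moreover have "integrable P (\<lambda>w. \<integral>x. v x (Z w) \<partial>\<Lambda>)"
    proof -
      interpret \<Lambda>P: pair_sigma_finite \<Lambda> P ..
      show ?thesis using \<Lambda>P.integrable_snd[OF integrable_product[OF v_meas v finite_\<Lambda> sets_\<Lambda>]] by simp
    qed
    ultimately have "(\<integral>w. \<bar>\<integral>x. v x (Z w) \<partial>\<Lambda>\<bar> \<partial>P) \<le> (\<integral>w. ?l \<partial>P)"
      by (intro integral_mono) auto
    then show ?thesis by (intro order_trans[OF integral_abs_bound]) (simp add: prob_space)
  qed
  ultimately show ?thesis by simp
qed

text \<open>
  The Poisson half of the interpolation, with the other half frozen at \<open>K\<close>.
\<close>

definition immigrate :: "('a multiset \<Rightarrow> real) \<Rightarrow> real \<Rightarrow> 'a multiset \<Rightarrow> real" where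
  "immigrate h t K = (\<integral>w. thin (1 - t) (Z w) (\<lambda>M. h (K + M)) \<partial>P)"

context
  fixes h :: "'a multiset \<Rightarrow> real"
  assumes h_meas [measurable]: "h \<in> borel_measurable multiset_space" and h: "mset_Lipschitz h"
begin

lemma integrable_thin_shift:
  assumes "t \<in> {0..1}"
  shows "integrable P (\<lambda>w. thin (1 - t) (Z w) (\<lambda>M. h (K + M)))"
proof (rule integrable_thin)
  show "\<bar>h (K + M)\<bar> \<le> (\<bar>h {#}\<bar> + size K) + real (size M)" for M
    using mset_Lipschitz_growth[OF h] by simp
qed (use assms in auto)

lemma borel_measurable_immigrate [measurable]: "immigrate h t \<in> borel_measurable multiset_space"
  unfolding immigrate_def by measurable

lemma immigrate_1 [simp]: "immigrate h 1 K = h K"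
  by (simp add: immigrate_def prob_space)

lemma immigrate_0: "immigrate h 0 {#} = (\<integral>w. h (Z w) \<partial>P)"
  by (simp add: immigrate_def)

lemma immigrate_diff:
  assumes "t \<in> {0..1}"
  shows "immigrate h t K - immigrate h t K' =
    (\<integral>w. thin (1 - t) (Z w) (\<lambda>M. h (K + M) - h (K' + M)) \<partial>P)"
  using integrable_thin_shift[OF assms] by (simp add: immigrate_def thin_diff)

lemma abs_immigrate_diff_le:
  assumes t: "t \<in> {0..1}" and le: "\<And>M. \<bar>h (K + M) - h (K' + M)\<bar> \<le> 1"
  shows "\<bar>immigrate h t K - immigrate h t K'\<bar> \<le> 1"
proof -
  have "\<bar>thin (1 - t) (Z w) (\<lambda>M. h (K + M) - h (K' + M))\<bar> \<le> 1" for w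
    using t le by (intro abs_thin_le) auto
  then have "(\<integral>w. \<bar>thin (1 - t) (Z w) (\<lambda>M. h (K + M) - h (K' + M))\<bar> \<partial>P) \<le> (\<integral>w. 1 \<partial>P)"
    using integrable_thin_shift[OF t]
    by (intro integral_mono) (auto simp: thin_diff)
  then show ?thesis
    unfolding immigrate_diff[OF t] by (intro order_trans[OF integral_abs_bound]) (simp add: prob_space)
qed

lemma mset_Lipschitz_immigrate:
  assumes "t \<in> {0..1}"
  shows "mset_Lipschitz (immigrate h t)"
  using h assms by (auto simp: mset_Lipschitz_def intro!: abs_immigrate_diff_le)

text \<open>
  The derivative of the thinning of \<open>Z\<close> is a sum over the points of \<open>Z\<close>, which the Mecke formula turns
  into an integral with respect to \<open>\<Lambda>\<close>.
\<close>

lemma has_real_derivative_immigrate: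
  assumes t: "t \<in> {0..1}"
  shows "((\<lambda>t. immigrate h t K) has_real_derivative
    (\<integral>x. - (immigrate h t (add_mset x K) - immigrate h t K) \<partial>\<Lambda>)) (at t within {0..1})"
proof -
  define v where "v t x M = thin (1 - t) M (\<lambda>N. h (add_mset x K + N) - h (K + N))" for t x M
  have v_meas [measurable]: "(\<lambda>(x, M). v t x M) \<in> borel_measurable (borel \<Otimes>\<^sub>M multiset_space)" for t
    unfolding v_def case_prod_beta' by measurable
  have v: "\<bar>v t x M\<bar> \<le> 1" if "t \<in> {0..1}" for t x M
    unfolding v_def using h that by (intro abs_thin_le) (auto simp: mset_Lipschitz_def)
  have "((\<lambda>t. immigrate h t K) has_real_derivative (\<integral>w. - (\<Sum>x\<in>#Z w. v t x (Z w - {#x#})) \<partial>P)) (at t within {0..1})"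
    unfolding immigrate_def
  proof (rule has_real_derivative_integral[where B = "\<lambda>w. size (Z w)"])
    fix s :: real and w assume s: "s \<in> {0..1}"
    have D: "((\<lambda>p. thin p (Z w) (\<lambda>M. h (K + M))) has_real_derivative
        (\<Sum>x\<in>#Z w. v s x (Z w - {#x#}))) (at (1 - s))"
      using has_real_derivative_thin[of "\<lambda>_ M. h (K + M)" "\<lambda>_. 0" "1 - s" UNIV "Z w"]
        thin_diff[of "1 - s" "Z w" "\<lambda>_. 0" "\<lambda>_. 0"]
      by (simp add: v_def)
    show "((\<lambda>s. thin (1 - s) (Z w) (\<lambda>M. h (K + M))) has_real_derivative
        - (\<Sum>x\<in>#Z w. v s x (Z w - {#x#}))) (at s within {0..1})"
      by (rule DERIV_chain2[where g = "\<lambda>s. 1 - s", OF D, THEN DERIV_cong]) (auto intro!: derivative_eq_intros)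
    show "\<bar>- (\<Sum>x\<in>#Z w. v s x (Z w - {#x#}))\<bar> \<le> size (Z w)"
      using v[OF s] by (simp add: abs_sum_mset_le)
  qed (use t integrable_thin_shift integrable_size in auto)
  also have "(\<integral>w. - (\<Sum>x\<in>#Z w. v t x (Z w - {#x#})) \<partial>P) = - (\<integral>w. (\<integral>x. v t x (Z w) \<partial>\<Lambda>) \<partial>P)"
    using integral_mecke[OF v_meas v[OF t]] by simp
  also have "\<dots> = - (\<integral>x. (\<integral>w. v t x (Z w) \<partial>P) \<partial>\<Lambda>)"
    unfolding integral_product_swap[OF v_meas v[OF t] finite_\<Lambda> sets_\<Lambda>] ..
  also have "\<dots> = (\<integral>x. - (immigrate h t (add_mset x K) - immigrate h t K) \<partial>\<Lambda>)"
    unfolding immigrate_diff[OF t] v_def by simp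
  finally show ?thesis .
qed

text \<open>
  Let \<open>\<psi> t\<close> be the mean of \<open>h\<close> at the sum of a \<open>t\<close>-thinning of \<open>\<Xi>\<close> and an independent \<open>(1 - t)\<close>-thinning of \<open>Z\<close>.
  Then \<open>\<psi> 1\<close> and \<open>\<psi> 0\<close> are the two expectations to be compared, so it suffices to bound the derivative of \<open>\<psi>\<close>.
  With \<open>v x M\<close> the mean effect of adding \<open>x\<close> to the sum of a \<open>t\<close>-thinning of \<open>M\<close> and the thinned Poisson points,
  the points of \<open>\<Xi>\<close> that enter contribute the sum of \<open>v x (\<Xi> - {#x#})\<close> over \<open>x\<close> in \<open>\<Xi>\<close>, and the Poisson points
  that leave contribute the integral of \<open>v x \<Xi>\<close> with respect to \<open>\<Lambda>\<close>.  The difference is the quantity bounded in the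
  hypothesis, and \<open>v\<close> inherits the two bounds required there from the Lipschitz property of \<open>h\<close>.
\<close>

lemma stein_bound:
  fixes Q :: "'v measure" and \<Xi> :: "'v \<Rightarrow> 'a multiset"
  assumes Q: "random_mset Q \<Xi>"
    and C: "\<And>v. (\<lambda>(x, M). v x M) \<in> borel_measurable (borel \<Otimes>\<^sub>M multiset_space) \<Longrightarrow>
      (\<And>x M. \<bar>v x M\<bar> \<le> 1) \<Longrightarrow> (\<And>x y M. \<bar>v x M - v y M\<bar> \<le> (1::real)) \<Longrightarrow>
      \<bar>(\<integral>w. (\<Sum>x\<in>#\<Xi> w. v x (\<Xi> w - {#x#})) \<partial>Q) - (\<integral>w. (\<integral>x. v x (\<Xi> w) \<partial>\<Lambda>) \<partial>Q)\<bar> \<le> C"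
  shows "\<bar>(\<integral>w. h (\<Xi> w) \<partial>Q) - (\<integral>w. h (Z w) \<partial>P)\<bar> \<le> C"
proof -
  interpret Q: random_mset Q \<Xi> by (rule Q)
  interpret \<Lambda>: finite_measure \<Lambda> by (rule finite_\<Lambda>)
  interpret \<Lambda>Q: pair_sigma_finite \<Lambda> Q ..
  define g where "g = immigrate h"
  have g_meas [measurable]: "g t \<in> borel_measurable multiset_space" for t
    unfolding g_def by measurable
  have g: "mset_Lipschitz (g t)" if "t \<in> {0..1}" for t
    unfolding g_def by (rule mset_Lipschitz_immigrate[OF that])
  define v where "v t x M = thin t M (\<lambda>K. g t (add_mset x K) - g t K)" for t x M
  have v_meas [measurable]: "(\<lambda>(x, M). v t x M) \<in> borel_measurable (borel \<Otimes>\<^sub>M multiset_space)" for t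
    unfolding v_def case_prod_beta' by measurable
  have v: "\<bar>v t x M\<bar> \<le> 1" if t: "t \<in> {0..1}" for t x M
    unfolding v_def using g[OF t] t by (intro abs_thin_le) (auto simp: mset_Lipschitz_def)
  have v': "\<bar>v t x M - v t y M\<bar> \<le> 1" if t: "t \<in> {0..1}" for t x y M
    unfolding v_def thin_diff[symmetric] using g[OF t] t
    by (intro abs_thin_le) (auto simp: mset_Lipschitz_def)
  have int_\<Lambda>: "integrable \<Lambda> (\<lambda>x. g t (add_mset x K) - g t K)" if t: "t \<in> {0..1}" for t K
    by (rule \<Lambda>.integrable_const_bound[where B = 1]) (use g[OF t] in \<open>auto simp: mset_Lipschitz_def\<close>)
  have int_Q: "integrable Q (\<lambda>w. \<integral>x. v t x (\<Xi> w) \<partial>\<Lambda>)" if t: "t \<in> {0..1}" for t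
    using \<Lambda>Q.integrable_snd[OF Q.integrable_product[OF v_meas v[OF t] finite_\<Lambda> sets_\<Lambda>]] by simp
  let ?d = "\<lambda>t w. - (\<integral>x. v t x (\<Xi> w) \<partial>\<Lambda>) + (\<Sum>x\<in>#\<Xi> w. v t x (\<Xi> w - {#x#}))"
  \<comment> \<open>At \<open>t\<close> the Poisson points enter through \<open>g t\<close>, so thinning \<open>\<Xi>\<close> is all that remains.\<close>
  define \<psi> where "\<psi> t = (\<integral>w. thin t (\<Xi> w) (g t) \<partial>Q)" for t
  have "(\<psi> has_real_derivative (\<integral>w. ?d t w \<partial>Q)) (at t within {0..1})" if t: "t \<in> {0..1}" for t
    unfolding \<psi>_def
  proof (rule has_real_derivative_integral[where B = "\<lambda>w. measure \<Lambda> (space \<Lambda>) + size (\<Xi> w)"])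
    show "integrable Q (\<lambda>w. thin s (\<Xi> w) (g s))" if s: "s \<in> {0..1}" for s
      by (rule Q.integrable_thin[OF s g_meas, of _ "\<bar>g s {#}\<bar>"])
         (use mset_Lipschitz_growth[OF g[OF s], of "{#}"] in simp)
    show "?d t \<in> borel_measurable Q"
      using int_Q[OF t, THEN borel_measurable_integrable] by measurable
    show "integrable Q (\<lambda>w. measure \<Lambda> (space \<Lambda>) + real (size (\<Xi> w)))"
      using Q.integrable_size by simp
    fix s :: real and w assume s: "s \<in> {0..1}"
    have "((\<lambda>s. thin s (\<Xi> w) (g s)) has_real_derivative
        thin s (\<Xi> w) (\<lambda>K. \<integral>x. - (g s (add_mset x K) - g s K) \<partial>\<Lambda>) +
        (\<Sum>x\<in>#\<Xi> w. v s x (\<Xi> w - {#x#}))) (at s within {0..1})"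
      unfolding v_def
      by (rule has_real_derivative_thin) (unfold g_def, rule has_real_derivative_immigrate[OF s])
    also have "thin s (\<Xi> w) (\<lambda>K. \<integral>x. - (g s (add_mset x K) - g s K) \<partial>\<Lambda>) =
        (\<integral>x. thin s (\<Xi> w) (\<lambda>K. - (g s (add_mset x K) - g s K)) \<partial>\<Lambda>)"
      by (rule thin_integral(2)) (rule integrable_minus[OF int_\<Lambda>[OF s]])
    also have "\<dots> = - (\<integral>x. v s x (\<Xi> w) \<partial>\<Lambda>)"
      unfolding thin_uminus v_def by simp
    finally show "((\<lambda>s. thin s (\<Xi> w) (g s)) has_real_derivative ?d s w) (at s within {0..1})" .
    have "\<bar>\<integral>x. v s x (\<Xi> w) \<partial>\<Lambda>\<bar> \<le> measure \<Lambda> (space \<Lambda>)"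
    proof -
      have "integrable \<Lambda> (\<lambda>x. v s x (\<Xi> w))"
        unfolding v_def by (rule thin_integral(1)) (rule int_\<Lambda>[OF s])
      have "\<bar>\<integral>x. v s x (\<Xi> w) \<partial>\<Lambda>\<bar> \<le> (\<integral>x. \<bar>v s x (\<Xi> w)\<bar> \<partial>\<Lambda>)" by (rule integral_abs_bound)
      also have "\<dots> \<le> (\<integral>x. 1 \<partial>\<Lambda>)"
        using \<open>integrable \<Lambda> (\<lambda>x. v s x (\<Xi> w))\<close> by (intro integral_mono) (auto simp: v[OF s])
      finally show ?thesis by simp
    qed
    moreover have "\<bar>\<Sum>x\<in>#\<Xi> w. v s x (\<Xi> w - {#x#})\<bar> \<le> size (\<Xi> w)"
      by (rule abs_sum_mset_le) (rule v[OF s])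
    ultimately show "\<bar>?d s w\<bar> \<le> measure \<Lambda> (space \<Lambda>) + size (\<Xi> w)" by linarith
  qed (use t in auto)
  moreover have "norm (\<integral>w. ?d t w \<partial>Q) \<le> C" if t: "t \<in> {0..1}" for t
  proof -
    have "(\<integral>w. ?d t w \<partial>Q) =
        (\<integral>w. (\<Sum>x\<in>#\<Xi> w. v t x (\<Xi> w - {#x#})) \<partial>Q) - (\<integral>w. (\<integral>x. v t x (\<Xi> w) \<partial>\<Lambda>) \<partial>Q)"
      using int_Q[OF t] Q.integrable_sum_remove[OF v_meas v[OF t]] by simp
    with C[OF v_meas v[OF t] v'[OF t]] show ?thesis by simp
  qed
  ultimately have "norm (\<psi> 1 - \<psi> 0) \<le> C * norm (1 - 0 :: real)"
    by (intro field_differentiable_bound[where S = "{0..1}"]) auto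
  moreover have "\<psi> 1 = (\<integral>w. h (\<Xi> w) \<partial>Q)"
    by (simp add: \<psi>_def g_def)
  moreover have "\<psi> 0 = (\<integral>w. h (Z w) \<partial>P)"
    by (simp add: \<psi>_def g_def immigrate_0 Q.prob_space)
  ultimately show ?thesis by simp
qed

end

end

section \<open>Finite counting measures as multisets, and total variation\<close>

text \<open>
  A point is the intersection of a decreasing sequence of open sets.  The measures of these sets tend to zero
  and are integers, so one of them vanishes.
\<close>

lemma null_open_nbhd:
  fixes \<omega> :: "'a::{second_countable_topology, t1_space} measure"
  assumes [measurable_cong, simp]: "sets \<omega> = sets borel" and fin: "emeasure \<omega> UNIV < \<infinity>"
    and int: "\<And>A. A \<in> sets borel \<Longrightarrow> emeasure \<omega> A \<in> \<nat> \<union> {\<infinity>}"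
    and x: "emeasure \<omega> {x} = 0"
  shows "\<exists>U. open U \<and> x \<in> U \<and> emeasure \<omega> U = 0"
proof -
  obtain \<B> :: "nat \<Rightarrow> 'a set" where \<B>: "\<And>i. open (\<B> i)" "\<And>i. x \<in> \<B> i"
    "\<And>S. open S \<Longrightarrow> x \<in> S \<Longrightarrow> \<exists>i. \<B> i \<subseteq> S"
    using first_countable_basis[of x] by metis
  define V where "V n = (\<Inter>i\<le>n. \<B> i)" for n
  have V: "open (V n)" "x \<in> V n" for n using \<B> by (auto simp: V_def)
  have "(\<Inter>n. V n) = {x}"
  proof -
    have "y = x" if y: "\<And>n. y \<in> V n" for y
    proof (rule ccontr)
      assume "y \<noteq> x"
      then obtain U where "open U" "x \<in> U" "y \<notin> U" using t1_space[of x y] by auto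
      with \<B>(3)[of U] obtain i where "\<B> i \<subseteq> U" by auto
      moreover have "y \<in> \<B> i" using y[of i] by (auto simp: V_def)
      ultimately show False using \<open>y \<notin> U\<close> by auto
    qed
    with V show ?thesis by auto
  qed
  moreover have "(\<lambda>n. emeasure \<omega> (V n)) \<longlonglongrightarrow> emeasure \<omega> (\<Inter>n. V n)"
  proof (rule Lim_emeasure_decseq)
    show "range V \<subseteq> sets \<omega>" using V by auto
    show "decseq V" by (auto simp: decseq_def V_def)
    show "emeasure \<omega> (V i) \<noteq> \<infinity>" for i
      using fin emeasure_mono[of "V i" UNIV \<omega>] by (auto simp: top_unique)
  qed
  ultimately have "\<forall>\<^sub>F n in sequentially. emeasure \<omega> (V n) < 1"
    using x by (intro order_tendstoD(2)) auto
  then obtain n where "emeasure \<omega> (V n) < 1" by (auto simp: eventually_sequentially)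
  moreover have "emeasure \<omega> (V n) \<in> \<nat> \<union> {\<infinity>}" using V by (intro int) auto
  ultimately have "emeasure \<omega> (V n) = 0"
    by (auto elim!: Nats_cases)
  with V show ?thesis by blast
qed

text \<open>
  Second countability reduces a cover by open null sets to a countable one.
\<close>

lemma null_if_no_atoms:
  fixes \<omega> :: "'a::{second_countable_topology, t1_space} measure"
  assumes [measurable_cong, simp]: "sets \<omega> = sets borel" and fin: "emeasure \<omega> UNIV < \<infinity>"
    and int: "\<And>A. A \<in> sets borel \<Longrightarrow> emeasure \<omega> A \<in> \<nat> \<union> {\<infinity>}"
    and no_atoms: "\<And>x. emeasure \<omega> {x} = 0"
  shows "emeasure \<omega> UNIV = 0"
proof -
  obtain \<B> :: "'a set set" where \<B>: "countable \<B>" "topological_basis \<B>"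
    using ex_countable_basis by auto
  have "x \<in> \<Union>{b \<in> \<B>. emeasure \<omega> b = 0}" for x
  proof -
    obtain U where U: "open U" "x \<in> U" "emeasure \<omega> U = 0"
      using null_open_nbhd[OF assms(1) fin int no_atoms] by blast
    then obtain b where "b \<in> \<B>" "x \<in> b" "b \<subseteq> U" using topological_basisE[OF \<B>(2)] by metis
    moreover have "emeasure \<omega> b = 0"
      using emeasure_mono[OF \<open>b \<subseteq> U\<close>, of \<omega>] U by auto
    ultimately show ?thesis by auto
  qed
  then have "UNIV = (\<Union>b\<in>{b \<in> \<B>. emeasure \<omega> b = 0}. b)" by blast
  moreover have "(\<Union>b\<in>{b \<in> \<B>. emeasure \<omega> b = 0}. b) \<in> null_sets \<omega>"
    using \<B> topological_basis_open[OF \<B>(2)] by (intro null_sets_UN') (auto simp: null_sets_def)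
  ultimately show ?thesis by (auto simp: null_sets_def)
qed

lemma counts_sum_replicate:
  "finite S \<Longrightarrow> counts A (\<Sum>x\<in>S. replicate_mset (n x) x) = (\<Sum>x\<in>S. of_bool (x \<in> A) * n x)"
proof (induction S rule: finite_induct)
  case (insert x S)
  have "counts A (replicate_mset k x) = of_bool (x \<in> A) * k" for k by (induction k) auto
  with insert show ?case by simp
qed simp

text \<open>
  The atoms have integer mass, so there are finitely many of them, and what remains after removing
  them is integer-valued without atoms, hence zero.
\<close>

lemma finite_counting_measure_eq_mset_measure:
  fixes \<omega> :: "'a::{second_countable_topology, t1_space} measure"
  assumes "\<omega> \<in> finite_counting_measures"
  shows "\<exists>M. mset_measure M = \<omega>"
proof -
  have sets [measurable_cong, simp]: "sets \<omega> = sets borel" and fin: "emeasure \<omega> UNIV < \<infinity>"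
    and int: "\<And>A. A \<in> sets borel \<Longrightarrow> emeasure \<omega> A \<in> \<nat> \<union> {\<infinity>}"
    using assms by (auto simp: finite_counting_measures_def counting_measures_def)
  have fin': "emeasure \<omega> A < \<infinity>" for A
  proof -
    have "emeasure \<omega> A \<le> emeasure \<omega> UNIV"
      using emeasure_space[of \<omega> A] sets_eq_imp_space_eq[OF sets] by simp
    then show ?thesis using fin by (rule order.strict_trans1)
  qed
  define n where "n x = (SOME k. emeasure \<omega> {x} = of_nat k)" for x
  have n: "emeasure \<omega> {x} = of_nat (n x)" for x
  proof -
    have "emeasure \<omega> {x} \<in> \<nat>" using int[of "{x}"] fin'[of "{x}"] by auto
    then show ?thesis unfolding n_def by (intro someI_ex[of "\<lambda>k. emeasure \<omega> {x} = of_nat k"]) (auto elim: Nats_cases)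
  qed
  obtain N where N: "emeasure \<omega> UNIV = of_nat N" using int[of UNIV] fin by (auto elim: Nats_cases)
  define S where "S = {x. n x \<noteq> 0}"
  have card_le: "card T \<le> N" if T: "finite T" "T \<subseteq> S" for T
  proof -
    have "of_nat (card T) = (\<Sum>x\<in>T. 1 :: ennreal)" by simp
    also have "\<dots> \<le> (\<Sum>x\<in>T. emeasure \<omega> {x})"
    proof (intro sum_mono)
      fix x assume "x \<in> T"
      with T have "1 \<le> n x" by (auto simp: S_def)
      then have "(of_nat 1 :: ennreal) \<le> of_nat (n x)" by (simp only: of_nat_le_iff)
      then show "1 \<le> emeasure \<omega> {x}" by (simp add: n)
    qed
    also have "\<dots> = emeasure \<omega> T"
      using T by (intro emeasure_eq_sum_singleton[symmetric]) auto
    also have "\<dots> \<le> of_nat N" unfolding N[symmetric] by (intro emeasure_mono) auto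
    finally show ?thesis by simp
  qed
  have S: "finite S"
  proof (rule ccontr)
    assume "infinite S"
    then obtain T where "finite T" "card T = Suc N" "T \<subseteq> S" by (meson infinite_arbitrarily_large)
    with card_le[of T] show False by simp
  qed
  have S_meas [measurable]: "S \<in> sets borel" using S by (simp add: finite_imp_closed)
  have restr: "emeasure (density \<omega> (indicator (- S))) A = emeasure \<omega> (A - S)" if "A \<in> sets borel" for A
    using that by (simp add: emeasure_density indicator_inter_arith[symmetric] Int_commute Diff_eq)
  have "emeasure (density \<omega> (indicator (- S))) UNIV = 0"
  proof (rule null_if_no_atoms)
    show "emeasure (density \<omega> (indicator (- S))) {x} = 0" for x
    proof (cases "x \<in> S")
      case False
      then have "{x} - S = {x}" "n x = 0" by (auto simp: S_def)
      then show ?thesis using n[of x] restr[of "{x}"] by simp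
    qed (simp add: restr)
    show "emeasure (density \<omega> (indicator (- S))) A \<in> \<nat> \<union> {\<infinity>}" if "A \<in> sets borel" for A
      using that int[of "A - S"] by (simp add: restr)
  qed (use restr fin' in auto)
  then have null: "emeasure \<omega> (- S) = 0" using restr[of UNIV] by (simp add: Compl_eq_Diff_UNIV[symmetric])
  have "mset_measure (\<Sum>x\<in>S. replicate_mset (n x) x) = \<omega>"
  proof (rule measure_eqI)
    fix A assume "A \<in> sets (mset_measure (\<Sum>x\<in>S. replicate_mset (n x) x))"
    then have A [measurable]: "A \<in> sets borel" by simp
    have "emeasure \<omega> A = emeasure \<omega> (A \<inter> S) + emeasure \<omega> (A - S)"
      by (subst plus_emeasure) (auto intro!: arg_cong[where f = "emeasure \<omega>"])
    also have "emeasure \<omega> (A - S) = 0"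
      using null emeasure_mono[of "A - S" "- S" \<omega>] by auto
    also have "emeasure \<omega> (A \<inter> S) = (\<Sum>x\<in>A \<inter> S. emeasure \<omega> {x})"
      using S by (intro emeasure_eq_sum_singleton) auto
    also have "\<dots> = (\<Sum>x\<in>S. of_nat (of_bool (x \<in> A) * n x))"
      using S by (intro sum.mono_neutral_cong_left) (auto simp: n)
    finally show "emeasure (mset_measure (\<Sum>x\<in>S. replicate_mset (n x) x)) A = emeasure \<omega> A"
      using S by (simp add: emeasure_mset_measure counts_sum_replicate)
  qed simp
  then show ?thesis ..
qed

lemma mset_measure_in_finite_counting_measures [simp]: "mset_measure M \<in> finite_counting_measures"
proof -
  have "emeasure (mset_measure M) UNIV < \<infinity>"
    by (simp add: emeasure_mset_measure of_nat_less_top)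
  moreover from this have "finite_measure (mset_measure M)"
    by (intro finite_measureI) auto
  then have "sigma_finite_measure (mset_measure M)"
    by (simp add: finite_measure_def)
  ultimately show ?thesis
    by (auto simp: finite_counting_measures_def counting_measures_def emeasure_mset_measure)
qed

text \<open>
  The inverse of \<open>mset_measure\<close> on finite counting measures; the empty multiset is a default value elsewhere.
\<close>

definition points :: "'a::{second_countable_topology, t1_space} measure \<Rightarrow> 'a multiset" where
  "points \<omega> = (if \<omega> \<in> finite_counting_measures then SOME M. mset_measure M = \<omega> else {#})"

lemma mset_measure_points: "\<omega> \<in> finite_counting_measures \<Longrightarrow> mset_measure (points \<omega>) = \<omega>"
  using someI_ex[OF finite_counting_measure_eq_mset_measure] by (simp add: points_def)

lemma mset_measure_inject:
  fixes M N :: "'a::t1_space multiset"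
  assumes "mset_measure M = mset_measure N"
  shows "M = N"
proof (rule multiset_eqI)
  fix x
  have "count M x = counts {x} M" for M :: "'a multiset"
    by (induction M) auto
  moreover have "counts {x} M = counts {x} N"
    using arg_cong[OF assms, of "\<lambda>\<omega>. emeasure \<omega> {x}"] by (simp add: emeasure_mset_measure)
  ultimately show "count M x = count N x" by simp
qed

lemma points_mset_measure [simp]: "points (mset_measure M) = M"
  by (rule mset_measure_inject) (simp add: mset_measure_points)

lemma counts_points:
  assumes "\<omega> \<in> finite_counting_measures" "A \<in> sets borel"
  shows "of_nat (counts A (points \<omega>)) = emeasure \<omega> A"
  using emeasure_mset_measure[OF assms(2), of "points \<omega>"] mset_measure_points[OF assms(1)] by simp

lemma space_evaluation_space [simp]: "space (evaluation_space S) = S"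
  unfolding evaluation_space_def by (subst space_Sup_eq_UN) auto

lemma measurable_evaluation_emeasure [measurable]:
  assumes "A \<in> sets borel"
  shows "(\<lambda>\<omega>. emeasure \<omega> A) \<in> borel_measurable (evaluation_space S)"
  unfolding evaluation_space_def
  by (rule measurable_SUP1[OF assms]) (auto intro: measurable_vimage_algebra1)

lemma measurable_into_evaluation_space:
  assumes "\<And>w. w \<in> space N \<Longrightarrow> f w \<in> S"
    and "\<And>A. A \<in> sets borel \<Longrightarrow> (\<lambda>w. emeasure (f w) A) \<in> borel_measurable N"
  shows "f \<in> measurable N (evaluation_space S)"
  unfolding evaluation_space_def
  using assms by (intro measurable_SUP2 measurable_vimage_algebra2) (auto intro: sets.top)

lemma measurable_points [measurable]: "points \<in> measurable counting_space multiset_space"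
proof (rule measurable_multiset_spaceI)
  fix A :: "'a set" assume A [measurable]: "A \<in> sets borel"
  have "counts A (points \<omega>) = (if emeasure \<omega> UNIV < \<infinity> then nat \<lfloor>enn2real (emeasure \<omega> A)\<rfloor> else 0)"
    if "\<omega> \<in> space counting_space" for \<omega> :: "'a measure"
  proof (cases "emeasure \<omega> UNIV < \<infinity>")
    case True
    with that have "\<omega> \<in> finite_counting_measures" by (simp add: finite_counting_measures_def)
    with True show ?thesis
      by (simp add: counts_points[OF _ A, symmetric] ennreal_of_nat_eq_real_of_nat)
  qed (simp add: points_def finite_counting_measures_def)
  then show "(\<lambda>\<omega>. counts A (points \<omega>)) \<in> measurable counting_space (count_space UNIV)"
    by (subst measurable_cong) (assumption, measurable)
qed

lemma measurable_mset_measure [measurable]: "mset_measure \<in> measurable multiset_space finite_counting_space"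
  by (rule measurable_into_evaluation_space) (simp_all add: emeasure_mset_measure)

lemma finite_counting_measures_iff:
  "\<omega> \<in> counting_measures \<Longrightarrow> \<omega> \<in> finite_counting_measures \<longleftrightarrow> emeasure \<omega> UNIV < \<infinity>"
  by (simp add: finite_counting_measures_def)

lemma emeasure_measure_add:
  assumes "sets \<mu> = sets borel" "sets \<nu> = sets borel" "A \<in> sets borel"
  shows "emeasure (measure_add \<mu> \<nu>) A = emeasure \<mu> A + emeasure \<nu> A"
proof (rule emeasure_measure_of[OF measure_add_def])
  show "sets \<mu> \<subseteq> Pow (space \<mu>)" by (rule sets.space_closed)
  have sets: "sets (measure_add \<mu> \<nu>) = sets \<mu>" by (simp add: measure_add_def)
  show "A \<in> sets (measure_add \<mu> \<nu>)" using assms by (simp add: sets)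
  show "countably_additive (sets (measure_add \<mu> \<nu>)) (\<lambda>A. emeasure \<mu> A + emeasure \<nu> A)"
    unfolding sets
  proof (rule countably_additiveI)
    fix B :: "nat \<Rightarrow> 'a set" assume B: "range B \<subseteq> sets \<mu>" "disjoint_family B"
    then show "(\<Sum>i. emeasure \<mu> (B i) + emeasure \<nu> (B i)) = emeasure \<mu> (\<Union> (range B)) + emeasure \<nu> (\<Union> (range B))"
      using assms by (simp add: suminf_add[symmetric] suminf_emeasure)
  qed
qed (simp add: positive_def)

lemma sets_measure_add [simp]: "sets (measure_add \<mu> \<nu>) = sets \<mu>"
  by (simp add: measure_add_def)

lemma measure_add_return:
  fixes M :: "'a::{second_countable_topology, t1_space} multiset"
  shows "measure_add (mset_measure M) (return borel x) = mset_measure (add_mset x M)"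
  by (rule measure_eqI) (auto simp: emeasure_measure_add emeasure_mset_measure add.commute indicator_def)

text \<open>
  At a point where the multiplicities differ, one of the two truncated differences is a positive integer.
\<close>

lemma multiset_sym_diff_ge_1:
  fixes M N :: "'a::{second_countable_topology, t1_space} multiset"
  assumes "M \<noteq> N"
  shows "1 \<le> emeasure (multiset_sym_diff (mset_measure M) (mset_measure N)) UNIV"
proof -
  have count: "emeasure (mset_measure M) {x} = of_nat (count M x)" for M and x :: 'a
  proof -
    have "count M x = counts {x} M" by (induction M) auto
    then show ?thesis by (simp add: emeasure_mset_measure)
  qed
  have diff: "1 \<le> emeasure (multiset_diff (mset_measure M) (mset_measure N)) UNIV"
    if lt: "count N x < count M x" for M N and x :: 'a
  proof -
    let ?f = "\<lambda>y. emeasure (mset_measure M) {y} - emeasure (mset_measure N) {y}"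
    have "1 \<le> ?f x"
    proof -
      have "?f x = of_nat (count M x - count N x)" using lt by (simp add: count ennreal_of_nat_eq_real_of_nat ennreal_minus of_nat_diff)
      with lt show ?thesis by (metis One_nat_def Suc_leI of_nat_1 of_nat_le_iff zero_less_diff)
    qed
    also have "?f x = (\<integral>\<^sup>+y. ?f y * indicator {x} y \<partial>count_space UNIV)" by simp
    also have "\<dots> \<le> (\<integral>\<^sup>+y. ?f y \<partial>count_space UNIV)"
      by (intro nn_integral_mono) (auto simp: indicator_def)
    also have "\<dots> = emeasure (multiset_diff (mset_measure M) (mset_measure N)) UNIV"
      by (simp add: multiset_diff_def emeasure_distr emeasure_density)
    finally show ?thesis .
  qed
  from assms obtain x where "count M x \<noteq> count N x" by (auto simp: multiset_eq_iff)
  then have "1 \<le> emeasure (multiset_diff (mset_measure M) (mset_measure N)) UNIV \<or>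
      1 \<le> emeasure (multiset_diff (mset_measure N) (mset_measure M)) UNIV"
    using diff[of N x M] diff[of M x N] by linarith
  then show ?thesis
    unfolding multiset_sym_diff_def
    by (subst emeasure_measure_add) (auto simp: multiset_diff_def intro: order_trans[OF _ add_increasing] add_increasing2 add_increasing)
qed

lemma d_TV_mset_measure_le:
  fixes M N :: "'a::{second_countable_topology, t1_space} multiset"
  assumes "\<And>A. \<bar>real (counts A M) - real (counts A N)\<bar> \<le> 1"
  shows "d_TV (mset_measure M) (mset_measure N) \<le> 1"
  unfolding d_TV_def using assms
  by (intro SUP_least) (simp add: measure_def emeasure_mset_measure ennreal_of_nat_eq_real_of_nat)

lemma mset_Lipschitz_mset_measure:
  fixes h :: "'a::{second_countable_topology, t1_space} measure \<Rightarrow> real"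
  assumes h: "h \<in> TV_Lipschitz"
  shows "mset_Lipschitz (\<lambda>M. h (mset_measure M))"
proof -
  have "\<bar>h (mset_measure M) - h (mset_measure N)\<bar> \<le> 1"
    if "\<And>A. \<bar>real (counts A M) - real (counts A N)\<bar> \<le> 1" for M N
  proof -
    have "ennreal \<bar>h (mset_measure M) - h (mset_measure N)\<bar> \<le> d_TV (mset_measure M) (mset_measure N)"
      using h by (simp add: TV_Lipschitz_def)
    also have "\<dots> \<le> 1" by (rule d_TV_mset_measure_le) (rule that)
    finally show ?thesis by simp
  qed
  then show ?thesis by (simp add: mset_Lipschitz_def)
qed

text \<open>
  The values of \<open>g\<close> lie in an interval \<open>[c, c + 1]\<close> with \<open>-1 \<le> c \<le> 0\<close>.  On the Hahn set \<open>Y\<close>, where \<open>\<mu>\<close> dominates,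
  replacing \<open>g\<close> by \<open>c + 1\<close> increases the difference of the integrals, and on the complement replacing it by \<open>c\<close> does.
  Each of the two mass differences is at most \<open>D\<close>, and the weights \<open>c + 1\<close> and \<open>-c\<close> add up to one.
\<close>

lemma integral_diff_le_setwise_bound:
  fixes \<mu> \<nu> :: "'a::topological_space measure" and g :: "'a \<Rightarrow> real"
  assumes \<mu>: "finite_measure \<mu>" "sets \<mu> = sets borel" and \<nu>: "finite_measure \<nu>" "sets \<nu> = sets borel"
    and D: "\<And>A. A \<in> sets borel \<Longrightarrow> \<bar>measure \<mu> A - measure \<nu> A\<bar> \<le> D"
    and g [measurable]: "g \<in> borel_measurable borel" and bound: "\<And>x. \<bar>g x\<bar> \<le> 1"
    and osc: "\<And>x y. \<bar>g x - g y\<bar> \<le> 1"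
  shows "(\<integral>x. g x \<partial>\<mu>) - (\<integral>x. g x \<partial>\<nu>) \<le> D"
proof -
  interpret \<mu>: finite_measure \<mu> by fact
  interpret \<nu>: finite_measure \<nu> by fact
  note [measurable_cong] = \<mu>(2) \<nu>(2)
  have space: "space \<mu> = UNIV" "space \<nu> = UNIV"
    using \<mu>(2) \<nu>(2) by (auto dest: sets_eq_imp_space_eq)
  define c where "c = min 0 (INF x. g x)"
  have bdd: "bdd_below (range g)" using bound by (intro bdd_belowI[of _ "-1"]) (auto simp: abs_le_iff)
  have "-1 \<le> (INF x. g x)" using bound by (intro cINF_greatest) (auto simp: abs_le_iff)
  then have c: "-1 \<le> c" "c \<le> 0" by (auto simp: c_def)
  have c_le: "c \<le> g x" for x
    using cINF_lower[OF bdd, of x] by (auto simp: c_def)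
  have le_c: "g x \<le> c + 1" for x
  proof -
    have "g x - 1 \<le> g y" for y using osc[of x y] by (auto simp: abs_le_iff)
    then have "g x - 1 \<le> (INF y. g y)" by (intro cINF_greatest) auto
    moreover have "g x - 1 \<le> 0" using bound[of x] by simp
    ultimately show ?thesis by (simp add: c_def)
  qed
  obtain Y where Y [measurable]: "Y \<in> sets borel" and
    in_Y: "\<And>X. X \<in> sets borel \<Longrightarrow> X \<subseteq> Y \<Longrightarrow> emeasure \<nu> X \<le> emeasure \<mu> X" and
    out_Y: "\<And>X. X \<in> sets borel \<Longrightarrow> X \<inter> Y = {} \<Longrightarrow> emeasure \<mu> X \<le> emeasure \<nu> X"
    using finite_unsigned_Hahn_decomposition[OF \<mu>(1) \<nu>(1)] \<mu>(2) \<nu>(2) by metis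
  have mono: "(\<integral>x. k x * indicator E x \<partial>\<sigma>) \<le> (\<integral>x. k x * indicator E x \<partial>\<tau>)"
    if fin: "finite_measure \<sigma>" "finite_measure \<tau>"
      and sets: "sets \<sigma> = sets borel" "sets \<tau> = sets borel" and E [measurable]: "E \<in> sets borel"
      and le: "\<And>X. X \<in> sets borel \<Longrightarrow> X \<subseteq> E \<Longrightarrow> emeasure \<sigma> X \<le> emeasure \<tau> X"
      and [measurable]: "k \<in> borel_measurable borel" and k: "\<And>x. 0 \<le> k x" "\<And>x. k x \<le> 1"
    for \<sigma> \<tau> :: "'a measure" and E and k :: "'a \<Rightarrow> real"
  proof -
    note [measurable_cong] = sets
    interpret \<tau>: finite_measure \<tau> by fact
    have "(\<integral>\<^sup>+x. ennreal (k x * indicator E x) \<partial>\<sigma>) = (\<integral>\<^sup>+x. ennreal (k x) \<partial>density \<sigma> (indicator E))"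
      by (subst nn_integral_density) (auto intro!: nn_integral_cong simp: indicator_def)
    also have "\<dots> \<le> (\<integral>\<^sup>+x. ennreal (k x) \<partial>density \<tau> (indicator E))"
    proof (rule nn_integral_mono_measure)
      show "density \<sigma> (indicator E) \<le> density \<tau> (indicator E)"
      proof (subst le_measure)
        show "\<forall>A\<in>Sigma_Algebra.sets (density \<sigma> (indicator E)).
            emeasure (density \<sigma> (indicator E)) A \<le> emeasure (density \<tau> (indicator E)) A"
          using le[of "E \<inter> _"] by (auto simp: emeasure_density sets indicator_inter_arith[symmetric])
      qed (simp add: sets)
    qed (simp add: sets)
    also have "\<dots> = (\<integral>\<^sup>+x. ennreal (k x * indicator E x) \<partial>\<tau>)"
      by (subst nn_integral_density) (auto intro!: nn_integral_cong simp: indicator_def)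
    finally have *: "(\<integral>\<^sup>+x. ennreal (k x * indicator E x) \<partial>\<sigma>) \<le> (\<integral>\<^sup>+x. ennreal (k x * indicator E x) \<partial>\<tau>)" .
    have "integrable \<tau> (\<lambda>x. k x * indicator E x)"
      by (rule \<tau>.integrable_const_bound[where B = 1]) (use k in \<open>auto simp: indicator_def\<close>)
    then have "(\<integral>\<^sup>+x. ennreal (k x * indicator E x) \<partial>\<tau>) < \<infinity>"
      using k by (simp add: nn_integral_eq_integral)
    with * show ?thesis
      using k by (simp add: integral_eq_nn_integral enn2real_mono)
  qed
  have int: "integrable \<mu> (\<lambda>x. g x * indicator E x)" "integrable \<nu> (\<lambda>x. g x * indicator E x)"
    if [measurable]: "E \<in> sets borel" for E
    by (rule \<mu>.integrable_const_bound[where B = 1] \<nu>.integrable_const_bound[where B = 1];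
        use bound in \<open>auto simp: indicator_def\<close>)+
  have int': "integrable \<mu> (\<lambda>x. a * indicator E x)" "integrable \<nu> (\<lambda>x. a * indicator E x)"
      "(\<integral>x. a * indicator E x \<partial>\<mu>) = a * measure \<mu> E" "(\<integral>x. a * indicator E x \<partial>\<nu>) = a * measure \<nu> E"
    if [measurable]: "E \<in> sets borel" for E and a :: real
    using \<mu>.emeasure_finite \<nu>.emeasure_finite
    by (auto simp: less_top[symmetric] \<mu>(2) \<nu>(2))
  have "(\<integral>x. (c + 1 - g x) * indicator Y x \<partial>\<nu>) \<le> (\<integral>x. (c + 1 - g x) * indicator Y x \<partial>\<mu>)"
    using c le_c c_le in_Y by (intro mono) (auto simp: \<mu> \<nu> algebra_simps)
  then have 1: "(\<integral>x. g x * indicator Y x \<partial>\<mu>) - (\<integral>x. g x * indicator Y x \<partial>\<nu>) \<le> (c + 1) * (measure \<mu> Y - measure \<nu> Y)"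
    using int[OF Y] int'[OF Y, of "c + 1"] by (simp add: left_diff_distrib right_diff_distrib)
  have "(\<integral>x. (g x - c) * indicator (- Y) x \<partial>\<mu>) \<le> (\<integral>x. (g x - c) * indicator (- Y) x \<partial>\<nu>)"
    using c le_c c_le out_Y by (intro mono) (auto simp: \<mu> \<nu> algebra_simps)
  then have 2: "(\<integral>x. g x * indicator (- Y) x \<partial>\<mu>) - (\<integral>x. g x * indicator (- Y) x \<partial>\<nu>) \<le> (- c) * (measure \<nu> (- Y) - measure \<mu> (- Y))"
    using int[of "- Y"] int'[of "- Y" c] by (simp add: left_diff_distrib right_diff_distrib)
  have split: "(\<integral>x. g x \<partial>\<sigma>) = (\<integral>x. g x * indicator Y x \<partial>\<sigma>) + (\<integral>x. g x * indicator (- Y) x \<partial>\<sigma>)"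
    if "integrable \<sigma> (\<lambda>x. g x * indicator Y x)" "integrable \<sigma> (\<lambda>x. g x * indicator (- Y) x)" for \<sigma>
  proof -
    have "(\<lambda>x. g x * indicator Y x + g x * indicator (- Y) x) = g"
      by (auto simp: fun_eq_iff indicator_def)
    then show ?thesis using Bochner_Integration.integral_add[OF that] by simp
  qed
  have "(\<integral>x. g x \<partial>\<mu>) - (\<integral>x. g x \<partial>\<nu>) \<le>
      (c + 1) * (measure \<mu> Y - measure \<nu> Y) + (- c) * (measure \<nu> (- Y) - measure \<mu> (- Y))"
    using 1 2 int[OF Y] int[of "- Y"] by (simp add: split)
  also have "\<dots> \<le> (c + 1) * D + (- c) * D"
    using D[OF Y] D[of "- Y"] c by (intro add_mono mult_left_mono) (auto simp: abs_le_iff)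
  finally show ?thesis by (simp add: algebra_simps)
qed

lemma integral_diff_le_d_TV:
  fixes \<mu> \<nu> :: "'a::topological_space measure" and g :: "'a \<Rightarrow> real"
  assumes \<mu>: "finite_measure \<mu>" "sets \<mu> = sets borel" and \<nu>: "finite_measure \<nu>" "sets \<nu> = sets borel"
    and g [measurable]: "g \<in> borel_measurable borel" and bound: "\<And>x. \<bar>g x\<bar> \<le> 1"
    and osc: "\<And>x y. \<bar>g x - g y\<bar> \<le> 1"
  shows "ennreal \<bar>(\<integral>x. g x \<partial>\<mu>) - (\<integral>x. g x \<partial>\<nu>)\<bar> \<le> d_TV \<mu> \<nu>"
proof (cases "d_TV \<mu> \<nu>" rule: ennreal_cases)
  case (real D)
  interpret \<mu>: finite_measure \<mu> by fact
  interpret \<nu>: finite_measure \<nu> by fact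
  have D: "\<bar>measure \<mu> A - measure \<nu> A\<bar> \<le> D" if "A \<in> sets borel" for A
  proof -
    have fin: "emeasure \<mu> A < \<infinity>" "emeasure \<nu> A < \<infinity>"
      by (simp_all add: less_top[symmetric])
    have "ennreal \<bar>measure \<mu> A - measure \<nu> A\<bar> \<le> d_TV \<mu> \<nu>"
      unfolding d_TV_def using that fin by (intro SUP_upper) simp
    with real show ?thesis by simp
  qed
  have "(\<integral>x. g x \<partial>\<mu>) - (\<integral>x. g x \<partial>\<nu>) \<le> D"
    by (rule integral_diff_le_setwise_bound[OF \<mu> \<nu> D g bound osc])
  moreover have "(\<integral>x. - g x \<partial>\<mu>) - (\<integral>x. - g x \<partial>\<nu>) \<le> D"
    by (rule integral_diff_le_setwise_bound[OF \<mu> \<nu> D]) (use bound osc in \<open>auto simp: abs_minus_commute\<close>)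
  ultimately show ?thesis using real by simp
qed simp

section \<open>Point processes as random multisets\<close>

lemma sets_intensity [simp, measurable_cong]: "sets (intensity P \<xi>) = sets borel"
  by (simp add: intensity_def sets.sigma_sets_eq[of borel, simplified])

lemma space_intensity [simp]: "space (intensity P \<xi>) = UNIV"
  using sets_eq_imp_space_eq[OF sets_intensity, of P \<xi>] by simp

lemma point_process_in_counting_measures:
  "point_process P \<xi> \<Longrightarrow> w \<in> space P \<Longrightarrow> \<xi> w \<in> counting_measures"
  using measurable_space[of \<xi> P counting_space w] by (simp add: point_process_def)

lemma emeasure_intensity:
  assumes "point_process P \<xi>" "A \<in> sets borel"
  shows "emeasure (intensity P \<xi>) A = (\<integral>\<^sup>+w. emeasure (\<xi> w) A \<partial>P)"
proof (rule emeasure_measure_of[OF intensity_def])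
  have \<xi> [measurable]: "\<xi> \<in> measurable P counting_space" using assms by (simp add: point_process_def)
  show "countably_additive (sets (intensity P \<xi>)) (\<lambda>A. \<integral>\<^sup>+w. emeasure (\<xi> w) A \<partial>P)"
  proof (rule countably_additiveI)
    fix B :: "nat \<Rightarrow> 'b set" assume B: "range B \<subseteq> sets (intensity P \<xi>)" "disjoint_family B"
    then have [measurable]: "B i \<in> sets borel" for i by auto
    have "(\<Sum>i. \<integral>\<^sup>+w. emeasure (\<xi> w) (B i) \<partial>P) = (\<integral>\<^sup>+w. (\<Sum>i. emeasure (\<xi> w) (B i)) \<partial>P)"
      by (rule nn_integral_suminf[symmetric]) measurable
    also have "\<dots> = (\<integral>\<^sup>+w. emeasure (\<xi> w) (\<Union> (range B)) \<partial>P)"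
    proof (rule nn_integral_cong)
      fix w assume "w \<in> space P"
      then have "sets (\<xi> w) = sets borel"
        using point_process_in_counting_measures[OF assms(1)] by (auto simp: counting_measures_def)
      then show "(\<Sum>i. emeasure (\<xi> w) (B i)) = emeasure (\<xi> w) (\<Union> (range B))"
        using B by (intro suminf_emeasure) auto
    qed
    finally show "(\<Sum>i. \<integral>\<^sup>+w. emeasure (\<xi> w) (B i) \<partial>P) = (\<integral>\<^sup>+w. emeasure (\<xi> w) (\<Union> (range B)) \<partial>P)" .
  qed
qed (use assms in \<open>auto simp: positive_def\<close>)

lemma random_mset_points:
  fixes \<xi> :: "'w \<Rightarrow> 'a::{second_countable_topology, t2_space} measure"
  assumes \<xi>: "finite_point_process P \<xi>" and fin: "emeasure (intensity P \<xi>) UNIV < \<infinity>"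
  shows "random_mset P (\<lambda>w. points (\<xi> w))"
    and "ennreal (\<integral>w. size (points (\<xi> w)) \<partial>P) = emeasure (intensity P \<xi>) UNIV"
proof -
  have pp: "point_process P \<xi>" and fcm: "\<And>w. w \<in> space P \<Longrightarrow> \<xi> w \<in> finite_counting_measures"
    using \<xi> by (auto simp: finite_point_process_def)
  interpret prob_space P using pp by (simp add: point_process_def)
  have \<xi>_meas [measurable]: "\<xi> \<in> measurable P counting_space" using pp by (simp add: point_process_def)
  have size: "of_nat (size (points (\<xi> w))) = emeasure (\<xi> w) UNIV" if "w \<in> space P" for w
    using counts_points[OF fcm[OF that], of UNIV] by simp
  then have eq: "(\<integral>\<^sup>+w. ennreal (real (size (points (\<xi> w)))) \<partial>P) = emeasure (intensity P \<xi>) UNIV"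
    by (subst emeasure_intensity[OF pp])
       (auto intro!: nn_integral_cong simp: ennreal_of_nat_eq_real_of_nat[symmetric])
  have int: "integrable P (\<lambda>w. real (size (points (\<xi> w))))"
    using fin by (intro integrableI_bounded) (simp_all add: eq)
  show "random_mset P (\<lambda>w. points (\<xi> w))"
    by unfold_locales (use int in auto)
  show "ennreal (\<integral>w. size (points (\<xi> w)) \<partial>P) = emeasure (intensity P \<xi>) UNIV"
    unfolding eq[symmetric] by (rule nn_integral_eq_integral[symmetric]) (use int in auto)
qed

text \<open>
  The Poisson weights of the total count add up to one.
\<close>

lemma AE_finite_poisson_process:
  assumes \<zeta>: "poisson_process P M \<zeta>" and fin: "emeasure M UNIV < \<infinity>"
  shows "AE w in P. \<zeta> w \<in> finite_counting_measures"
proof -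
  have pp: "point_process P \<zeta>" using \<zeta> by (simp add: poisson_process_def)
  interpret prob_space P using pp by (simp add: point_process_def)
  have \<zeta>_meas [measurable]: "\<zeta> \<in> measurable P counting_space" using pp by (simp add: point_process_def)
  define l where "l = measure M UNIV"
  let ?E = "\<lambda>k::nat. {w \<in> space P. emeasure (\<zeta> w) UNIV = of_nat k}"
  have p: "prob (?E k) = l ^ k / fact k * exp (- l)" for k
    using \<zeta> fin by (simp add: poisson_process_def l_def)
  have "(\<lambda>k. l ^ k / fact k * exp (- l)) sums (exp l * exp (- l))"
    using exp_converges[of l] by (intro sums_mult2) (simp add: scaleR_conv_of_real divide_inverse mult.commute)
  then have "(\<lambda>k. prob (?E k)) sums 1" by (simp add: p exp_minus)
  moreover have "(\<lambda>k. prob (?E k)) sums prob (\<Union>k. ?E k)"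
    by (rule finite_measure_UNION) (auto simp: disjoint_family_on_def)
  ultimately have "prob (\<Union>k. ?E k) = 1" by (rule sums_unique2[symmetric])
  then have "AE w in P. w \<in> (\<Union>k. ?E k)" by (intro prob_eq_1[THEN iffD1]) auto
  then show ?thesis
  proof (rule AE_mp, intro AE_I2 impI)
    fix w assume "w \<in> space P" "w \<in> (\<Union>k. ?E k)"
    then show "\<zeta> w \<in> finite_counting_measures"
      using point_process_in_counting_measures[OF pp] by (auto simp: finite_counting_measures_def of_nat_less_top)
  qed
qed

lemma (in prob_space) indep_vars_cong_AE:
  assumes X: "indep_vars N X I"
    and Y: "\<And>i. i \<in> I \<Longrightarrow> Y i \<in> measurable M (N i)"
    and eq: "\<And>i. i \<in> I \<Longrightarrow> AE w in M. X i w = Y i w" and I: "finite I"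
  shows "indep_vars N Y I"
proof (cases "I = {}")
  case True
  then show ?thesis by (simp add: indep_vars_def indep_sets_def)
next
  case False
  have X': "X i \<in> measurable M (N i)" if "i \<in> I" for i using X that by (simp add: indep_vars_def)
  have "distr M (PiM I N) (\<lambda>w. \<lambda>i\<in>I. Y i w) = distr M (PiM I N) (\<lambda>w. \<lambda>i\<in>I. X i w)"
  proof (rule distr_cong_AE)
    have "AE w in M. \<forall>i\<in>I. X i w = Y i w" using eq I by (intro AE_finite_allI) auto
    then show "AE w in M. (\<lambda>i\<in>I. Y i w) = (\<lambda>i\<in>I. X i w)" by eventually_elim auto
  qed (auto intro!: measurable_restrict X' Y)
  also have "\<dots> = (\<Pi>\<^sub>M i\<in>I. distr M (N i) (X i))"
    using X False X' by (subst indep_vars_iff_distr_eq_PiM'[symmetric]) auto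
  also have "\<dots> = (\<Pi>\<^sub>M i\<in>I. distr M (N i) (Y i))"
    using eq X' Y by (intro PiM_cong distr_cong_AE refl) auto
  finally show ?thesis
    using False Y by (subst indep_vars_iff_distr_eq_PiM') auto
qed

text \<open>
  Almost surely all counts of \<open>\<zeta>\<close> are finite and agree with those of its multiset of points, and neither
  the distribution nor the independence of the counts changes on a null set.
\<close>

lemma poisson_mset_points:
  fixes \<zeta> :: "'w \<Rightarrow> 'a::{second_countable_topology, t2_space} measure"
  assumes \<zeta>: "poisson_process P M \<zeta>" and fin: "emeasure M UNIV < \<infinity>"
  shows "poisson_mset P (\<lambda>w. points (\<zeta> w)) M"
proof -
  have pp: "point_process P \<zeta>" and M: "sets M = sets borel" using \<zeta> by (simp_all add: poisson_process_def)
  interpret prob_space P using pp by (simp add: point_process_def)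
  have \<zeta>_meas [measurable]: "\<zeta> \<in> measurable P counting_space" using pp by (simp add: point_process_def)
  have fin_M: "finite_measure M"
    using fin sets_eq_imp_space_eq[OF M] by (intro finite_measureI) auto
  note AE_fin = AE_finite_poisson_process[OF \<zeta> fin]
  have AE_counts: "AE w in P. of_nat (counts B (points (\<zeta> w))) = emeasure (\<zeta> w) B" if "B \<in> sets borel" for B
    using AE_fin by eventually_elim (rule counts_points[OF _ that])
  show ?thesis
  proof (intro poisson_mset.intro poisson_mset_axioms.intro)
    fix B :: "'a set" and k :: nat
    assume B [measurable]: "B \<in> sets borel"
    have "emeasure M B \<le> emeasure M UNIV"
      using emeasure_space[of M B] sets_eq_imp_space_eq[OF M] by simp
    then have "emeasure M B < \<infinity>" using fin by (rule order.strict_trans1)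
    then have "prob {w \<in> space P. emeasure (\<zeta> w) B = of_nat k} = measure M B ^ k / fact k * exp (- measure M B)"
      using \<zeta> B by (simp add: poisson_process_def)
    moreover have "prob {w \<in> space P. counts B (points (\<zeta> w)) = k} = prob {w \<in> space P. emeasure (\<zeta> w) B = of_nat k}"
    proof (rule finite_measure_eq_AE)
      show "AE w in P. (w \<in> {w \<in> space P. counts B (points (\<zeta> w)) = k}) = (w \<in> {w \<in> space P. emeasure (\<zeta> w) B = of_nat k})"
        using AE_counts[OF B]
      proof eventually_elim
        case (elim w)
        show ?case by (simp only: mem_Collect_eq elim[symmetric] of_nat_eq_iff)
      qed
    qed measurable
    ultimately show "prob {w \<in> space P. counts B (points (\<zeta> w)) = k} = measure M B ^ k / fact k * exp (- measure M B)"
      by simp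
  next
    fix B :: "nat \<Rightarrow> 'a set" and n :: nat
    assume B: "\<And>i. i < n \<Longrightarrow> B i \<in> sets borel" and disj: "disjoint_family_on B {..<n}"
    have "indep_vars (\<lambda>_. borel) (\<lambda>i w. emeasure (\<zeta> w) (B i)) {..<n}"
      using \<zeta> B disj by (simp add: poisson_process_def)
    then have "indep_vars (\<lambda>_. count_space UNIV) (\<lambda>i w. nat \<lfloor>enn2real (emeasure (\<zeta> w) (B i))\<rfloor>) {..<n}"
      by (rule indep_vars_compose2) measurable
    then show "indep_vars (\<lambda>_. count_space UNIV) (\<lambda>i w. counts (B i) (points (\<zeta> w))) {..<n}"
    proof (rule indep_vars_cong_AE)
      fix i assume "i \<in> {..<n}"
      then have Bi [measurable]: "B i \<in> sets borel" using B by simp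
      show "(\<lambda>w. counts (B i) (points (\<zeta> w))) \<in> measurable P (count_space UNIV)" by measurable
      show "AE w in P. nat \<lfloor>enn2real (emeasure (\<zeta> w) (B i))\<rfloor> = counts (B i) (points (\<zeta> w))"
        using AE_counts[OF Bi]
      proof eventually_elim
        case (elim w)
        show ?case unfolding elim[symmetric] ennreal_of_nat_eq_real_of_nat by simp
      qed
    qed simp
  qed (use M fin_M prob_space_axioms in auto)
qed

lemma set_integral_points:
  fixes \<xi> :: "'w \<Rightarrow> 'a::{second_countable_topology, t2_space} measure"
  assumes \<xi>: "point_process P \<xi>" and fin: "AE w in P. \<xi> w \<in> finite_counting_measures"
    and h: "h \<in> TV_Lipschitz"
  shows "(LINT w:{w \<in> space P. \<xi> w \<in> finite_counting_measures}|P. h (\<xi> w)) =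
    (\<integral>w. h (mset_measure (points (\<xi> w))) \<partial>P)"
proof -
  have [measurable]: "\<xi> \<in> measurable P counting_space" using \<xi> by (simp add: point_process_def)
  have [measurable]: "h \<in> borel_measurable finite_counting_space" using h by (simp add: TV_Lipschitz_def)
  let ?F = "{w \<in> space P. \<xi> w \<in> finite_counting_measures}"
  have "?F = {w \<in> space P. emeasure (\<xi> w) UNIV < \<infinity>}"
    using point_process_in_counting_measures[OF \<xi>] by (auto simp: finite_counting_measures_iff)
  also have "\<dots> \<in> sets P" by measurable
  finally have [measurable]: "?F \<in> sets P" .
  have "(LINT w:?F|P. h (\<xi> w)) = (\<integral>w. indicator ?F w *\<^sub>R h (mset_measure (points (\<xi> w))) \<partial>P)"
    unfolding set_lebesgue_integral_def
    by (intro Bochner_Integration.integral_cong) (auto simp: indicator_def mset_measure_points)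
  also have "\<dots> = (\<integral>w. h (mset_measure (points (\<xi> w))) \<partial>P)"
  proof (rule integral_cong_AE)
    show "AE w in P. indicator ?F w *\<^sub>R h (mset_measure (points (\<xi> w))) = h (mset_measure (points (\<xi> w)))"
      using fin AE_space[of P] by eventually_elim simp
  qed measurable
  finally show ?thesis .
qed

text \<open>
  The Palm formula for the indicator of infinite total mass, whose left-hand side vanishes.
\<close>

lemma AE_finite_palm:
  fixes \<xi> :: "'w \<Rightarrow> 'a::{second_countable_topology, t2_space} measure"
  assumes \<xi>: "finite_point_process P \<xi>" and palm: "reduced_palm_version P \<xi> R \<eta>"
  shows "AE x in intensity P \<xi>. AE w in R x. \<eta> x w \<in> finite_counting_measures"
proof -
  let ?L = "intensity P \<xi>"
  define f where "f = (\<lambda>(x::'a, \<omega>::'a measure). if emeasure \<omega> UNIV = \<infinity> then 1 else 0 :: real)"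
  have f [measurable]: "f \<in> borel_measurable (borel \<Otimes>\<^sub>M counting_space)" unfolding f_def by measurable
  have f_nn: "\<forall>z. 0 \<le> f z" by (auto simp: f_def)
  let ?a = "\<lambda>x. \<integral>\<^sup>+w. ennreal (f (x, measure_add (\<eta> x w) (return borel x))) \<partial>R x"
  have a_meas: "?a \<in> borel_measurable (completion ?L)"
    and a_eq: "(\<integral>\<^sup>+w. (\<integral>\<^sup>+x. ennreal (f (x, \<xi> w)) \<partial>\<xi> w) \<partial>P) = (\<integral>\<^sup>+x. ?a x \<partial>?L)"
    using palm f f_nn unfolding reduced_palm_version_def by blast+
  have "(\<integral>\<^sup>+w. (\<integral>\<^sup>+x. ennreal (f (x, \<xi> w)) \<partial>\<xi> w) \<partial>P) = (\<integral>\<^sup>+w. 0 \<partial>P)"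
    using \<xi> by (intro nn_integral_cong)
      (auto simp: f_def finite_point_process_def finite_counting_measures_def)
  then have "(\<integral>\<^sup>+x. ?a x \<partial>completion ?L) = 0" using a_eq by (simp add: nn_integral_completion)
  then have "AE x in completion ?L. ?a x = 0" using nn_integral_0_iff_AE[OF a_meas] by simp
  then have "AE x in ?L. ?a x = 0" by (simp add: AE_completion_iff)
  moreover have "AE x in ?L. point_process (R x) (\<eta> x)" using palm by (simp add: reduced_palm_version_def)
  ultimately show ?thesis
  proof eventually_elim
    case (elim x)
    have [measurable]: "\<eta> x \<in> measurable (R x) counting_space" using elim by (simp add: point_process_def)
    have eq: "ennreal (f (x, measure_add (\<eta> x w) (return borel x))) = (if emeasure (\<eta> x w) UNIV = \<infinity> then 1 else 0)"
      if "w \<in> space (R x)" for w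
    proof -
      have "sets (\<eta> x w) = sets borel"
        using point_process_in_counting_measures[OF elim(2) that] by (simp add: counting_measures_def)
      then show ?thesis by (simp add: f_def emeasure_measure_add)
    qed
    have "(\<integral>\<^sup>+w. (if emeasure (\<eta> x w) UNIV = \<infinity> then 1 else 0) \<partial>R x) = 0"
      using elim(1) by (simp add: eq cong: nn_integral_cong)
    then have "AE w in R x. (if emeasure (\<eta> x w) UNIV = \<infinity> then 1 else 0) = (0::ennreal)"
      by (subst nn_integral_0_iff_AE[symmetric]) auto
    then show ?case
    proof (rule AE_mp, intro AE_I2 impI)
      fix w assume "w \<in> space (R x)" "(if emeasure (\<eta> x w) UNIV = \<infinity> then 1 else 0) = (0::ennreal)"
      then show "\<eta> x w \<in> finite_counting_measures"
        using point_process_in_counting_measures[OF elim(2)]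
        by (auto simp: finite_counting_measures_iff less_top[symmetric] split: if_splits)
    qed
  qed
qed

text \<open>
  The Palm formula tested with a function of the point and of the configuration without that point, so that the
  point added to \<open>\<eta> x\<close> is removed again.  The right-hand side of the formula in the definition
  is measurable only for the completion and has the form below only where \<open>\<eta> x\<close> is almost surely finite, so
  it is kept as a function \<open>a\<close> that is identified almost everywhere.
\<close>

lemma palm_points:
  fixes \<xi> :: "'w \<Rightarrow> 'a::{second_countable_topology, t2_space} measure"
    and G :: "'a \<Rightarrow> 'a multiset \<Rightarrow> real"
  assumes \<xi>: "finite_point_process P \<xi>" and palm: "reduced_palm_version P \<xi> R \<eta>"
    and G [measurable]: "(\<lambda>(x, M). G x M) \<in> borel_measurable (borel \<Otimes>\<^sub>M multiset_space)" and "\<And>x M. 0 \<le> G x M"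
  obtains a where "a \<in> borel_measurable (completion (intensity P \<xi>))"
    "(\<integral>\<^sup>+w. (\<Sum>x\<in>#points (\<xi> w). ennreal (G x (points (\<xi> w) - {#x#}))) \<partial>P) = (\<integral>\<^sup>+x. a x \<partial>intensity P \<xi>)"
    "AE x in intensity P \<xi>. a x = (\<integral>\<^sup>+w. ennreal (G x (points (\<eta> x w))) \<partial>R x)"
proof -
  let ?L = "intensity P \<xi>"
  \<comment> \<open>The default value off the points is not seen by the sum on the left of the Palm formula.\<close>
  define f where "f = (\<lambda>(x, \<omega>). if x \<in># points \<omega> then G x (points \<omega> - {#x#}) else 0)"
  have f [measurable]: "f \<in> borel_measurable (borel \<Otimes>\<^sub>M counting_space)"
  proof -
    have [measurable]: "(\<lambda>z. G (fst z) (points (snd z) - {#fst z#})) \<in> borel_measurable (borel \<Otimes>\<^sub>M counting_space)"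
      by measurable
    show ?thesis unfolding f_def case_prod_beta' by measurable
  qed
  let ?a = "\<lambda>x. \<integral>\<^sup>+w. ennreal (f (x, measure_add (\<eta> x w) (return borel x))) \<partial>R x"
  have f_nn: "\<forall>z. 0 \<le> f z" using assms(4) by (auto simp: f_def)
  have a_meas: "?a \<in> borel_measurable (completion ?L)"
    and a_eq: "(\<integral>\<^sup>+w. (\<integral>\<^sup>+x. ennreal (f (x, \<xi> w)) \<partial>\<xi> w) \<partial>P) = (\<integral>\<^sup>+x. ?a x \<partial>?L)"
    using palm f f_nn unfolding reduced_palm_version_def by blast+
  have "(\<integral>\<^sup>+x. ennreal (f (x, \<xi> w)) \<partial>\<xi> w) = (\<Sum>x\<in>#points (\<xi> w). ennreal (G x (points (\<xi> w) - {#x#})))"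
    if w: "w \<in> space P" for w
  proof -
    have fcm: "\<xi> w \<in> finite_counting_measures" using \<xi> w by (simp add: finite_point_process_def)
    then have cm: "\<xi> w \<in> space counting_space" by (simp add: finite_counting_measures_def)
    have [measurable]: "(\<lambda>x. f (x, \<xi> w)) \<in> borel_measurable borel"
      by (rule measurable_compose[OF measurable_Pair2'[OF cm] f])
    have "(\<integral>\<^sup>+x. ennreal (f (x, \<xi> w)) \<partial>\<xi> w) = (\<integral>\<^sup>+x. ennreal (f (x, \<xi> w)) \<partial>mset_measure (points (\<xi> w)))"
      by (simp add: mset_measure_points[OF fcm])
    also have "\<dots> = (\<Sum>x\<in>#points (\<xi> w). ennreal (f (x, \<xi> w)))"
      by (rule nn_integral_mset_measure) measurable
    also have "\<dots> = (\<Sum>x\<in>#points (\<xi> w). ennreal (G x (points (\<xi> w) - {#x#})))"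
      by (intro arg_cong[where f = sum_mset] image_mset_cong) (simp add: f_def)
    finally show ?thesis .
  qed
  then have lhs: "(\<integral>\<^sup>+w. (\<Sum>x\<in>#points (\<xi> w). ennreal (G x (points (\<xi> w) - {#x#}))) \<partial>P) = (\<integral>\<^sup>+x. ?a x \<partial>?L)"
    unfolding a_eq[symmetric] by (intro nn_integral_cong) simp
  have "AE x in ?L. ?a x = (\<integral>\<^sup>+w. ennreal (G x (points (\<eta> x w))) \<partial>R x)"
    using AE_finite_palm[OF \<xi> palm]
  proof eventually_elim
    case (elim x)
    show ?case
    proof (rule nn_integral_cong_AE, use elim in eventually_elim)
      fix w assume "\<eta> x w \<in> finite_counting_measures"
      then have "measure_add (\<eta> x w) (return borel x) = mset_measure (add_mset x (points (\<eta> x w)))"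
        using measure_add_return[of "points (\<eta> x w)" x] by (simp add: mset_measure_points)
      then show "ennreal (f (x, measure_add (\<eta> x w) (return borel x))) = ennreal (G x (points (\<eta> x w)))"
        by (simp add: f_def)
    qed
  qed
  with a_meas lhs show thesis by (rule that)
qed

text \<open>
  Two values of \<open>u\<close> differ by at most two, and only if the configurations differ, in which case their
  symmetric difference has at least one point.  The mass of the symmetric difference need not be measurable in \<open>w\<close>, so
  its integral is compared with that of half the distance of the values of \<open>u\<close>, which is measurable, before
  the factor two is taken out of the integral.
\<close>

lemma coupling_bound:
  fixes X Y :: "'q \<Rightarrow> 'a::{second_countable_topology, t2_space} measure" and u :: "'a multiset \<Rightarrow> real"
  assumes X: "point_process Q X" "AE w in Q. X w \<in> finite_counting_measures"
    and Y: "point_process Q Y" "AE w in Q. Y w \<in> finite_counting_measures"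
    and [measurable]: "u \<in> borel_measurable multiset_space" and u: "\<And>M. \<bar>u M\<bar> \<le> 1"
  shows "(\<integral>\<^sup>+w. ennreal (1 + u (points (X w))) \<partial>Q) \<le>
      (\<integral>\<^sup>+w. ennreal (1 + u (points (Y w))) \<partial>Q) + 2 * (\<integral>\<^sup>+w. emeasure (multiset_sym_diff (X w) (Y w)) UNIV \<partial>Q)"
    and "(\<integral>\<^sup>+w. ennreal (1 + u (points (Y w))) \<partial>Q) \<le>
      (\<integral>\<^sup>+w. ennreal (1 + u (points (X w))) \<partial>Q) + 2 * (\<integral>\<^sup>+w. emeasure (multiset_sym_diff (X w) (Y w)) UNIV \<partial>Q)"
proof -
  have [measurable]: "X \<in> measurable Q counting_space" "Y \<in> measurable Q counting_space"
    using X Y by (simp_all add: point_process_def)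
  let ?d = "\<lambda>w. ennreal (\<bar>u (points (X w)) - u (points (Y w))\<bar> / 2)"
  have "(\<integral>\<^sup>+w. ?d w \<partial>Q) \<le> (\<integral>\<^sup>+w. emeasure (multiset_sym_diff (X w) (Y w)) UNIV \<partial>Q)"
  proof (rule nn_integral_mono_AE, use X(2) Y(2) in eventually_elim)
    fix w assume w: "X w \<in> finite_counting_measures" "Y w \<in> finite_counting_measures"
    show "?d w \<le> emeasure (multiset_sym_diff (X w) (Y w)) UNIV"
    proof (cases "points (X w) = points (Y w)")
      case False
      have "\<bar>u (points (X w)) - u (points (Y w))\<bar> / 2 \<le> 1"
        using u[of "points (X w)"] u[of "points (Y w)"] by (simp add: abs_le_iff)
      then have "?d w \<le> 1" by simp
      also have "1 \<le> emeasure (multiset_sym_diff (X w) (Y w)) UNIV"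
        using multiset_sym_diff_ge_1[OF False] w by (simp add: mset_measure_points)
      finally show ?thesis .
    qed simp
  qed
  then have d: "2 * (\<integral>\<^sup>+w. ?d w \<partial>Q) \<le> 2 * (\<integral>\<^sup>+w. emeasure (multiset_sym_diff (X w) (Y w)) UNIV \<partial>Q)"
    by (rule mult_left_mono) simp
  have *: "ennreal (1 + a) \<le> ennreal (1 + b) + 2 * ennreal (c / 2)" if "\<bar>b\<bar> \<le> 1" "a - b \<le> c" "0 \<le> c" for a b c :: real
  proof -
    have "2 * ennreal (c / 2) = ennreal c"
      using that by (simp add: ennreal_numeral[symmetric] ennreal_mult[symmetric] del: ennreal_numeral)
    then have "ennreal (1 + b) + 2 * ennreal (c / 2) = ennreal (1 + b + c)"
      using that by (simp add: abs_le_iff)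
    moreover have "ennreal (1 + a) \<le> ennreal (1 + b + c)" using that by (intro ennreal_leI) simp
    ultimately show ?thesis by simp
  qed
  have "(\<integral>\<^sup>+w. ennreal (1 + u (points (X w))) \<partial>Q) \<le> (\<integral>\<^sup>+w. ennreal (1 + u (points (Y w))) + 2 * ?d w \<partial>Q)"
    using u by (intro nn_integral_mono *) auto
  also have "\<dots> = (\<integral>\<^sup>+w. ennreal (1 + u (points (Y w))) \<partial>Q) + 2 * (\<integral>\<^sup>+w. ?d w \<partial>Q)"
    by (simp add: nn_integral_add nn_integral_cmult)
  finally show "(\<integral>\<^sup>+w. ennreal (1 + u (points (X w))) \<partial>Q) \<le>
      (\<integral>\<^sup>+w. ennreal (1 + u (points (Y w))) \<partial>Q) + 2 * (\<integral>\<^sup>+w. emeasure (multiset_sym_diff (X w) (Y w)) UNIV \<partial>Q)"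
    using d by (meson add_left_mono order_trans)
  have "(\<integral>\<^sup>+w. ennreal (1 + u (points (Y w))) \<partial>Q) \<le> (\<integral>\<^sup>+w. ennreal (1 + u (points (X w))) + 2 * ?d w \<partial>Q)"
    using u by (intro nn_integral_mono *) auto
  also have "\<dots> = (\<integral>\<^sup>+w. ennreal (1 + u (points (X w))) \<partial>Q) + 2 * (\<integral>\<^sup>+w. ?d w \<partial>Q)"
    by (simp add: nn_integral_add nn_integral_cmult)
  finally show "(\<integral>\<^sup>+w. ennreal (1 + u (points (Y w))) \<partial>Q) \<le>
      (\<integral>\<^sup>+w. ennreal (1 + u (points (X w))) \<partial>Q) + 2 * (\<integral>\<^sup>+w. emeasure (multiset_sym_diff (X w) (Y w)) UNIV \<partial>Q)"
    using d by (meson add_left_mono order_trans)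
qed

lemma AE_finite_cong_law:
  fixes X :: "'q \<Rightarrow> 'a::topological_space measure"
  assumes X: "point_process Q X" and Y: "point_process R Y"
    and law: "distr Q counting_space X = distr R counting_space Y"
    and fin: "AE w in R. Y w \<in> finite_counting_measures"
  shows "AE w in Q. X w \<in> finite_counting_measures"
proof -
  have [measurable]: "X \<in> measurable Q counting_space" "Y \<in> measurable R counting_space"
    using X Y by (simp_all add: point_process_def)
  have AE_iff: "(AE w in S. Z w \<in> finite_counting_measures) \<longleftrightarrow>
      (AE \<omega> in distr S counting_space Z. emeasure \<omega> UNIV < \<infinity>)" if Z: "point_process S Z"
    for S :: "'s measure" and Z :: "'s \<Rightarrow> 'a measure"
  proof -
    have [measurable]: "Z \<in> measurable S counting_space" using Z by (simp add: point_process_def)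
    have "(AE \<omega> in distr S counting_space Z. emeasure \<omega> UNIV < \<infinity>) \<longleftrightarrow> (AE w in S. emeasure (Z w) UNIV < \<infinity>)"
      by (rule AE_distr_iff) measurable
    also have "\<dots> \<longleftrightarrow> (AE w in S. Z w \<in> finite_counting_measures)"
      using point_process_in_counting_measures[OF Z]
      by (intro AE_cong) (simp add: finite_counting_measures_iff)
    finally show ?thesis ..
  qed
  show ?thesis using fin unfolding AE_iff[OF X] AE_iff[OF Y] law .
qed

lemma nn_integral_points_cong_law:
  fixes X :: "'q \<Rightarrow> 'a::{second_countable_topology, t2_space} measure" and g :: "'a multiset \<Rightarrow> ennreal"
  assumes X: "point_process Q X" and Y: "point_process R Y"
    and law: "distr Q counting_space X = distr R counting_space Y"
    and [measurable]: "g \<in> borel_measurable multiset_space"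
  shows "(\<integral>\<^sup>+w. g (points (X w)) \<partial>Q) = (\<integral>\<^sup>+w. g (points (Y w)) \<partial>R)"
proof -
  have [measurable]: "X \<in> measurable Q counting_space" "Y \<in> measurable R counting_space"
    using X Y by (simp_all add: point_process_def)
  have "(\<integral>\<^sup>+w. g (points (X w)) \<partial>Q) = (\<integral>\<^sup>+\<omega>. g (points \<omega>) \<partial>distr Q counting_space X)"
    by (rule nn_integral_distr[symmetric]) measurable
  also have "\<dots> = (\<integral>\<^sup>+w. g (points (Y w)) \<partial>R)"
    unfolding law by (rule nn_integral_distr) measurable
  finally show ?thesis .
qed

theorem theorem3p1:
  fixes P :: "'w measure" and \<xi> :: "'w \<Rightarrow> 'a::{second_countable_topology, t2_space} measure"
    and P' :: "'v measure" and \<zeta> :: "'v \<Rightarrow> 'a measure"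
    and M :: "'a measure"
    and R :: "'a \<Rightarrow> 'r measure" and \<eta> :: "'a \<Rightarrow> 'r \<Rightarrow> 'a measure"
    and Q :: "'a \<Rightarrow> 'q measure" and X Y :: "'a \<Rightarrow> 'q \<Rightarrow> 'a measure"
  assumes "locally_compact_space (euclidean :: 'a topology)"
    and "finite_point_process P \<xi>"
    and "emeasure (intensity P \<xi>) UNIV < \<infinity>"
    and "poisson_process P' M \<zeta>"
    and "emeasure M UNIV < \<infinity>"
    and "reduced_palm_version P \<xi> R \<eta>"
    and "AE x in intensity P \<xi>.
           point_process (Q x) (X x) \<and> point_process (Q x) (Y x) \<and>
           distr (Q x) counting_space (X x) = distr P counting_space \<xi> \<and>
           distr (Q x) counting_space (Y x) = distr (R x) counting_space (\<eta> x)"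
    and "(\<lambda>x. \<integral>\<^sup>+w. emeasure (multiset_sym_diff (X x w) (Y x w)) UNIV \<partial>Q x)
           \<in> borel_measurable (completion (intensity P \<xi>))"
  shows "d_KR P \<xi> P' \<zeta> \<le> d_TV (intensity P \<xi>) M +
           2 * (\<integral>\<^sup>+x. (\<integral>\<^sup>+w. emeasure (multiset_sym_diff (X x w) (Y x w)) UNIV \<partial>Q x)
                  \<partial>intensity P \<xi>)"
proof -
  let ?L = "intensity P \<xi>"
  let ?\<Xi> = "\<lambda>w. points (\<xi> w)" and ?Z = "\<lambda>w. points (\<zeta> w)"
  let ?e = "\<lambda>x. \<integral>\<^sup>+w. emeasure (multiset_sym_diff (X x w) (Y x w)) UNIV \<partial>Q x"
  note \<xi> = assms(2) and finL = assms(3) and \<zeta> = assms(4) and finM = assms(5) and palm = assms(6)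
    and coupling = assms(7) and e_meas = assms(8)
  have pp: "point_process P \<xi>" and pp_\<zeta>: "point_process P' \<zeta>" and sets_M: "sets M = sets borel"
    using \<xi> \<zeta> by (simp_all add: finite_point_process_def poisson_process_def)
  have AE_\<xi>: "AE w in P. \<xi> w \<in> finite_counting_measures"
    using \<xi> by (intro AE_I2) (simp add: finite_point_process_def)
  note AE_\<zeta> = AE_finite_poisson_process[OF \<zeta> finM]
  interpret \<Xi>: random_mset P ?\<Xi> by (rule random_mset_points(1)[OF \<xi> finL])
  interpret Z: poisson_mset P' ?Z M by (rule poisson_mset_points[OF \<zeta> finM])
  have L: "finite_measure ?L"
    using finL by (intro finite_measureI) simp
  interpret L: finite_measure ?L by (rule L)
  interpret M: finite_measure M by (rule Z.finite_\<Lambda>)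
  have mean: "(\<integral>w. size (?\<Xi> w) \<partial>P) = measure ?L (space ?L)"
    using random_mset_points(2)[OF \<xi> finL] by (simp add: L.emeasure_eq_measure)
  have key: "ennreal \<bar>(\<integral>w. (\<Sum>x\<in>#?\<Xi> w. v x (?\<Xi> w - {#x#})) \<partial>P) - (\<integral>w. (\<integral>x. v x (?\<Xi> w) \<partial>M) \<partial>P)\<bar>
      \<le> d_TV ?L M + 2 * (\<integral>\<^sup>+x. ?e x \<partial>?L)"
    if v_meas: "(\<lambda>(x, M). v x M) \<in> borel_measurable (borel \<Otimes>\<^sub>M multiset_space)"
      and v: "\<And>x M. \<bar>v x M\<bar> \<le> 1" and v': "\<And>x y M. \<bar>v x M - v y M\<bar> \<le> 1"
    for v :: "'a \<Rightarrow> 'a multiset \<Rightarrow> real"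
  proof -
    note v_meas [measurable]
    \<comment> \<open>\<open>?A1\<close> and \<open>?A2\<close> are compared by the coupling, \<open>?A2\<close> and \<open>?A3\<close> by the distance of the intensities.\<close>
    let ?A1 = "\<integral>w. (\<Sum>x\<in>#?\<Xi> w. v x (?\<Xi> w - {#x#})) \<partial>P"
      and ?A2 = "\<integral>w. (\<integral>x. v x (?\<Xi> w) \<partial>?L) \<partial>P" and ?A3 = "\<integral>w. (\<integral>x. v x (?\<Xi> w) \<partial>M) \<partial>P"
    let ?l = "measure ?L (space ?L)"
    have G_meas: "(\<lambda>(x, M). 1 + v x M) \<in> borel_measurable (borel \<Otimes>\<^sub>M multiset_space)"
      unfolding case_prod_beta' by measurable
    have G_nn: "0 \<le> 1 + v x M" for x M using v[of x M] by (simp add: abs_le_iff)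
    obtain a where a_meas: "a \<in> borel_measurable (completion ?L)"
      and a_eq: "(\<integral>\<^sup>+w. (\<Sum>x\<in>#?\<Xi> w. ennreal (1 + v x (?\<Xi> w - {#x#}))) \<partial>P) = (\<integral>\<^sup>+x. a x \<partial>?L)"
      and a_AE: "AE x in ?L. a x = (\<integral>\<^sup>+w. ennreal (1 + v x (points (\<eta> x w))) \<partial>R x)"
      using palm_points[OF \<xi> palm G_meas G_nn] by blast
    define b where "b x = (\<integral>\<^sup>+w. ennreal (1 + v x (?\<Xi> w)) \<partial>P)" for x
    have b_meas: "b \<in> borel_measurable (completion ?L)"
      unfolding b_def by (rule measurable_completion) measurable
    \<comment> \<open>\<open>a x\<close> and \<open>b x\<close> depend on the laws of the Palm version and of \<open>\<xi>\<close> only, so both can be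
      evaluated on the space of the coupling.\<close>
    have AE_ab: "AE x in ?L. a x \<le> b x + 2 * ?e x \<and> b x \<le> a x + 2 * ?e x"
      using a_AE coupling AE_finite_palm[OF \<xi> palm] palm[unfolded reduced_palm_version_def, THEN conjunct1]
    proof eventually_elim
      case (elim x)
      note XY = elim(2)[THEN conjunct1] elim(2)[THEN conjunct2, THEN conjunct1]
        elim(2)[THEN conjunct2, THEN conjunct2, THEN conjunct1] elim(2)[THEN conjunct2, THEN conjunct2, THEN conjunct2]
      have u [measurable]: "v x \<in> borel_measurable multiset_space"
        using measurable_compose[OF measurable_Pair1' v_meas, of x] by simp
      have "b x = (\<integral>\<^sup>+w. ennreal (1 + v x (points (X x w))) \<partial>Q x)"
        unfolding b_def by (rule nn_integral_points_cong_law[OF pp XY(1) XY(3)[symmetric]]) measurable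
      moreover have "a x = (\<integral>\<^sup>+w. ennreal (1 + v x (points (Y x w))) \<partial>Q x)"
        unfolding elim(1) by (rule nn_integral_points_cong_law[OF elim(4) XY(2) XY(4)[symmetric]]) measurable
      ultimately show ?case
        using coupling_bound[OF XY(1) AE_finite_cong_law[OF XY(1) pp XY(3) AE_\<xi>]
            XY(2) AE_finite_cong_law[OF XY(2) elim(4) XY(4) elim(3)] u v] by simp
    qed
    let ?E = "\<integral>\<^sup>+x. ?e x \<partial>?L"
    have add: "(\<integral>\<^sup>+x. c x + 2 * ?e x \<partial>?L) = (\<integral>\<^sup>+x. c x \<partial>?L) + 2 * ?E"
      if "c \<in> borel_measurable (completion ?L)" for c
    proof -
      have "(\<integral>\<^sup>+x. c x + 2 * ?e x \<partial>completion ?L) = (\<integral>\<^sup>+x. c x \<partial>completion ?L) + 2 * (\<integral>\<^sup>+x. ?e x \<partial>completion ?L)"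
        using that e_meas by (simp add: nn_integral_add nn_integral_cmult)
      then show ?thesis by (simp add: nn_integral_completion)
    qed
    have a_int: "(\<integral>\<^sup>+x. a x \<partial>?L) = ennreal (?l + ?A1)"
      unfolding a_eq[symmetric] \<Xi>.nn_integral_sum_remove[OF v_meas v] mean ..
    have b_int: "(\<integral>\<^sup>+x. b x \<partial>?L) = ennreal (?l + ?A2)"
      unfolding b_def by (rule \<Xi>.nn_integral_product[OF v_meas v L sets_intensity])
    have "(\<integral>\<^sup>+x. a x \<partial>?L) \<le> (\<integral>\<^sup>+x. b x + 2 * ?e x \<partial>?L)"
      using AE_ab by (intro nn_integral_mono_AE) auto
    then have ab: "ennreal (?l + ?A1) \<le> ennreal (?l + ?A2) + 2 * ?E"
      unfolding add[OF b_meas] a_int b_int .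
    have "(\<integral>\<^sup>+x. b x \<partial>?L) \<le> (\<integral>\<^sup>+x. a x + 2 * ?e x \<partial>?L)"
      using AE_ab by (intro nn_integral_mono_AE) auto
    then have ba: "ennreal (?l + ?A2) \<le> ennreal (?l + ?A1) + 2 * ?E"
      unfolding add[OF a_meas] a_int b_int .
    have "0 \<le> ?l + ?A1"
    proof -
      have "\<bar>?A1\<bar> \<le> (\<integral>w. size (?\<Xi> w) \<partial>P)"
        using \<Xi>.integrable_sum_remove[OF v_meas v] \<Xi>.integrable_size
        by (intro order_trans[OF integral_abs_bound] integral_mono) (auto intro!: abs_sum_mset_le v)
      then show ?thesis by (simp add: mean)
    qed
    have int_abs: "\<bar>\<integral>x. v x N \<partial>?L\<bar> \<le> ?l" for N
    proof -
      have [measurable]: "(\<lambda>x. v x N) \<in> borel_measurable borel"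
        using measurable_compose[OF measurable_Pair2' v_meas, of N] by simp
      have "integrable ?L (\<lambda>x. v x N)"
        by (rule L.integrable_const_bound[where B = 1]) (auto simp: v)
      then have "(\<integral>x. \<bar>v x N\<bar> \<partial>?L) \<le> (\<integral>x. 1 \<partial>?L)"
        by (intro integral_mono) (auto simp: v)
      then show ?thesis by (intro order_trans[OF integral_abs_bound]) simp
    qed
    have int_inner: "integrable P (\<lambda>w. \<integral>x. v x (?\<Xi> w) \<partial>\<Lambda>)"
      if \<Lambda>: "finite_measure \<Lambda>" "sets \<Lambda> = sets borel" for \<Lambda>
    proof -
      interpret \<Lambda>: finite_measure \<Lambda> by (rule \<Lambda>)
      interpret \<Lambda>P: pair_sigma_finite \<Lambda> P ..
      show ?thesis using \<Lambda>P.integrable_snd[OF \<Xi>.integrable_product[OF v_meas v \<Lambda>]] by simp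
    qed
    have "0 \<le> ?l + ?A2"
    proof -
      have "(\<integral>w. \<bar>\<integral>x. v x (?\<Xi> w) \<partial>?L\<bar> \<partial>P) \<le> (\<integral>w. ?l \<partial>P)"
        using int_inner[OF L sets_intensity] int_abs by (intro integral_mono) auto
      then have "\<bar>?A2\<bar> \<le> (\<integral>w. ?l \<partial>P)" by (rule order_trans[OF integral_abs_bound])
      then show ?thesis by (simp add: \<Xi>.prob_space)
    qed
    have A12: "ennreal \<bar>?A1 - ?A2\<bar> \<le> 2 * ?E"
    proof (cases "2 * ?E" rule: ennreal_cases)
      case (real r)
      with ab ba \<open>0 \<le> ?l + ?A1\<close> \<open>0 \<le> ?l + ?A2\<close> have "?l + ?A1 \<le> ?l + ?A2 + r" "?l + ?A2 \<le> ?l + ?A1 + r"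
        by (simp_all add: ennreal_plus[symmetric] del: ennreal_plus)
      then show ?thesis using real by (simp add: ennreal_leI abs_le_iff)
    qed simp
    have A23: "ennreal \<bar>?A2 - ?A3\<bar> \<le> d_TV ?L M"
    proof (cases "d_TV ?L M" rule: ennreal_cases)
      case (real r)
      have "\<bar>(\<integral>x. v x N \<partial>?L) - (\<integral>x. v x N \<partial>M)\<bar> \<le> r" for N
      proof -
        have [measurable]: "(\<lambda>x. v x N) \<in> borel_measurable borel"
          using measurable_compose[OF measurable_Pair2' v_meas, of N] by simp
        have "ennreal \<bar>(\<integral>x. v x N \<partial>?L) - (\<integral>x. v x N \<partial>M)\<bar> \<le> d_TV ?L M"
          by (rule integral_diff_le_d_TV[OF L sets_intensity Z.finite_\<Lambda> sets_M]) (auto simp: v v')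
        with real show ?thesis by simp
      qed
      then have "\<bar>\<integral>w. (\<integral>x. v x (?\<Xi> w) \<partial>?L) - (\<integral>x. v x (?\<Xi> w) \<partial>M) \<partial>P\<bar> \<le> (\<integral>w. r \<partial>P)"
        using int_inner[OF L sets_intensity] int_inner[OF Z.finite_\<Lambda> sets_M]
        by (intro order_trans[OF integral_abs_bound] integral_mono) auto
      then show ?thesis
        using real int_inner[OF L sets_intensity] int_inner[OF Z.finite_\<Lambda> sets_M]
        by (simp add: \<Xi>.prob_space ennreal_leI)
    qed simp
    have "ennreal \<bar>?A1 - ?A3\<bar> \<le> ennreal (\<bar>?A2 - ?A3\<bar> + \<bar>?A1 - ?A2\<bar>)"
      by (intro ennreal_leI) simp
    also have "\<dots> = ennreal \<bar>?A2 - ?A3\<bar> + ennreal \<bar>?A1 - ?A2\<bar>" by (rule ennreal_plus) simp_all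
    also have "\<dots> \<le> d_TV ?L M + 2 * ?E" using A23 A12 by (rule add_mono)
    finally show ?thesis .
  qed
  show ?thesis
    unfolding d_KR_def
  proof (rule SUP_least)
    fix h :: "'a measure \<Rightarrow> real" assume h: "h \<in> TV_Lipschitz"
    have [measurable]: "h \<in> borel_measurable finite_counting_space" using h by (simp add: TV_Lipschitz_def)
    have h_meas: "(\<lambda>M. h (mset_measure M)) \<in> borel_measurable multiset_space" by measurable
    show "ennreal \<bar>(LINT w:{w\<in>space P. \<xi> w \<in> finite_counting_measures}|P. h (\<xi> w)) -
                 (LINT w:{w\<in>space P'. \<zeta> w \<in> finite_counting_measures}|P'. h (\<zeta> w))\<bar> \<le>
        d_TV ?L M + 2 * (\<integral>\<^sup>+x. ?e x \<partial>?L)"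
    proof (cases "d_TV ?L M + 2 * (\<integral>\<^sup>+x. ?e x \<partial>?L)" rule: ennreal_cases)
      case (real C)
      have "\<bar>(\<integral>w. h (mset_measure (?\<Xi> w)) \<partial>P) - (\<integral>w. h (mset_measure (?Z w)) \<partial>P')\<bar> \<le> C"
      proof (rule Z.stein_bound[OF h_meas mset_Lipschitz_mset_measure[OF h] \<Xi>.random_mset_axioms])
        fix v :: "'a \<Rightarrow> 'a multiset \<Rightarrow> real"
        assume "(\<lambda>(x, M). v x M) \<in> borel_measurable (borel \<Otimes>\<^sub>M multiset_space)"
          "\<And>x M. \<bar>v x M\<bar> \<le> 1" "\<And>x y M. \<bar>v x M - v y M\<bar> \<le> 1"
        from key[OF this] real
        show "\<bar>(\<integral>w. (\<Sum>x\<in>#?\<Xi> w. v x (?\<Xi> w - {#x#})) \<partial>P) - (\<integral>w. (\<integral>x. v x (?\<Xi> w) \<partial>M) \<partial>P)\<bar> \<le> C"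
          by simp
      qed
      with real show ?thesis
        unfolding set_integral_points[OF pp AE_\<xi> h] set_integral_points[OF pp_\<zeta> AE_\<zeta> h]
        by (simp add: ennreal_leI)
    next
      case top
      show ?thesis unfolding top by (rule top_greatest)
    qed
  qed
qed

end
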